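(* Let $s\ge2$ and $t\ge1$ be coprime integers. If $\lambda$ is an $(s,t)$-core, then the stabiliser $\operatorname{Stab}_{s,t}(\lambda)$ of $\lambda$ under the level $t$ action of $\tilde{\mathfrak S}_s$ on $\mathcal C_s$ is isomorphic to the group generated by $\{r_j: j\in\mathbb Z/s\mathbb Z,\ x_\lambda\in H_j\}$.
   Context: Let $\mathbb N=\{1,2,\dots\}$ and $s\circ t=\frac12(s-1)(t-1)$ (an integer, since $s,t$ are coprime). A partition is a weakly decreasing sequence $\lambda=(\lambda_1,\lambda_2,\dots)$ of non-negative integers, eventually $0$; its conjugate is $\lambda'$ with $\lambda'_i=|\{j\ge1:\lambda_j\ge i\}|$. For $(r,c)\in\mathbb N^2$ with $c\le\lambda_r$, the $(r,c)$-hook length of $\lambda$ is $1+(\lambda_r-r)+(\lambda'_c-c)$. $\lambda$ is an $s$-core if none of its hook lengths equals $s$; $\mathcal C_s$ is the set of all $s$-cores; an $(s,t)$-core is an element of $\mathcal C_s\cap\mathcal C_t$. The beta-set of $\lambda$ is $\mathcal B^\lambda=\{\lambda_i-i: i\in\mathbb N\}$. Affine symmetric group: $\tilde{\mathfrak S}_s$ is the group of permutations $w$ of $\mathbb Z$ with $w(m+s)=w(m)+s$ for all $m$ and $w(0)+\dots+w(s-1)=\binom s2$. Elements of $\mathbb Z/s\mathbb Z$ are regarded as congruence classes, i.e. subsets of $\mathbb Z$; for $i\in\mathbb Z/s\mathbb Z$ and integers $a,b$, $ia+b$ denotes the class of $xa+b$ for $x\in i$. For $i\in\mathbb Z/s\mathbb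 Z$, $w_i\in\tilde{\mathfrak S}_s$ is given by $w_i(m)=m+1$ if $m\in i-1$, $w_i(m)=m-1$ if $m\in i$, and $w_i(m)=m$ otherwise; the $w_i$ generate $\tilde{\mathfrak S}_s$. Level $t$ action: the level $t$ action $w\mapsto\mathring w$ of $\tilde{\mathfrak S}_s$ on $\mathbb Z$ is the action determined on generators by $\mathring w_i(m)=m+t$ if $m\in(i-1)t-s\circ t$, $\mathring w_i(m)=m-t$ if $m\in it-s\circ t$, and $\mathring w_i(m)=m$ otherwise. The level $t$ action $w\mapsto\check w$ on $\mathcal C_s$ is defined by letting $\check w\lambda$ be the unique partition with $\mathcal B^{\check w\lambda}=\mathring w(\mathcal B^\lambda)$ (this is again an $s$-core). $s$-sets: for an $s$-core $\lambda$, $\mathcal S(\lambda)=\{a_i: i\in\mathbb Z/s\mathbb Z\}$, where $a_i$ is the smallest integer in $i$ not in $\mathcal B^\lambda$. Geometry: work in Euclidean space $\mathbb R^s$ with coordinates indexed by $\mathbb Z/s\mathbb Z$, and let $P^s=\{x\in\mathbb R^s:\sum_{i\in\mathbb Z/s\mathbb Z}x_i=\binom s2\}$. For $\lambda\in\mathcal C_s$, $x_\lambda\in P^s$ is the point whose coordinate $(x_\lambda)_i$ is the unique element of $\mathcal S(\lambda)\cap i$. For $j\in\mathbb Z/s\mathbb Z$, $H_j=\{x\in P^s: x_j-x_{j-t}=t\}$, and $r_j:P^s\to P^s$ is the orthogonal reflection in $H_j$ (with respect to the usual inner product). *)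

theory Defs
  imports
    "HOL-Analysis.Analysis"
    "HOL-Algebra.Group_Action"
    "HOL-Algebra.Generated_Groups"
    "Berlekamp_Zassenhaus.Finite_Field"
begin

text \<open>
  Sequences indexed by the positive integers are functions on \<^typ>\<open>nat\<close> whose value at \<open>0\<close>
  is fixed to be \<open>0\<close>, so that all indices below are 1-based.
\<close>

definition is_partition :: "(nat \<Rightarrow> nat) \<Rightarrow> bool" where
  "is_partition lam \<longleftrightarrow>
     lam 0 = 0 \<and> (\<forall>i\<ge>1. lam (Suc i) \<le> lam i) \<and> (\<exists>N. \<forall>i\<ge>N. lam i = 0)"

definition conjugate :: "(nat \<Rightarrow> nat) \<Rightarrow> nat \<Rightarrow> nat" where
  "conjugate lam i = card {j. 1 \<le> j \<and> i \<le> lam j}"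

definition hook_length :: "(nat \<Rightarrow> nat) \<Rightarrow> nat \<Rightarrow> nat \<Rightarrow> int" where
  "hook_length lam r c =
     1 + (int (lam r) - int r) + (int (conjugate lam c) - int c)"

definition cores :: "nat \<Rightarrow> (nat \<Rightarrow> nat) set" where
  "cores s = {lam. is_partition lam \<and>
     (\<forall>r c. 1 \<le> r \<and> 1 \<le> c \<and> c \<le> lam r \<longrightarrow> hook_length lam r c \<noteq> int s)}"

definition beta_set :: "(nat \<Rightarrow> nat) \<Rightarrow> int set" where
  "beta_set lam = {int (lam i) - int i | i. 1 \<le> i}"

definition affine_sym :: "nat \<Rightarrow> (int \<Rightarrow> int) monoid" where
  "affine_sym s = (BijGroup UNIV)\<lparr>carrier :=
     {w. bij w \<and> (\<forall>m. w (m + int s) = w m + int s) \<and>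
         (\<Sum>m\<in>{0..<int s}. w m) = int (s choose 2)}\<rparr>"

text \<open>
  From here on \<open>s\<close> is the cardinality of the type variable \<open>'s\<close>, and the ring
  \<open>\<int>/s\<int>\<close> is the type \<^typ>\<open>'s mod_ring\<close>. An element \<open>i\<close> of it
  corresponds to the subset \<open>residue_class i\<close> of the integers, and \<open>ia + b\<close> is computed in the ring.
\<close>

definition residue_class :: "'s::nontriv mod_ring \<Rightarrow> int set" where
  "residue_class i = {m. of_int m = i}"

definition circ :: "nat \<Rightarrow> nat \<Rightarrow> int" where
  "circ s t = (int s - 1) * (int t - 1) div 2"

definition affine_gen :: "'s::nontriv mod_ring \<Rightarrow> int \<Rightarrow> int" where
  "affine_gen i m =
     (if m \<in> residue_class (i - 1) then m + 1
      else if m \<in> residue_class i then m - 1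
      else m)"

definition level_gen :: "nat \<Rightarrow> 's::nontriv mod_ring \<Rightarrow> int \<Rightarrow> int" where
  "level_gen t i m =
     (if m \<in> residue_class ((i - 1) * of_nat t - of_int (circ CARD('s) t)) then m + int t
      else if m \<in> residue_class (i * of_nat t - of_int (circ CARD('s) t)) then m - int t
      else m)"

text \<open>
  The level \<open>t\<close> action on the integers is the unique action with the prescribed values on the
  generators; extensionality only fixes the irrelevant values outside the group.
\<close>

definition level_action :: "'s::nontriv itself \<Rightarrow> nat \<Rightarrow> (int \<Rightarrow> int) \<Rightarrow> int \<Rightarrow> int" where
  "level_action TYPE('s) t =
     (THE \<phi>. \<phi> \<in> extensional (carrier (affine_sym CARD('s))) \<and>
             group_action (affine_sym CARD('s)) UNIV \<phi> \<and>
             (\<forall>i::'s mod_ring. \<phi> (affine_gen i) = level_gen t i))"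

definition core_action ::
    "'s::nontriv itself \<Rightarrow> nat \<Rightarrow> (int \<Rightarrow> int) \<Rightarrow> (nat \<Rightarrow> nat) \<Rightarrow> (nat \<Rightarrow> nat)" where
  "core_action TYPE('s) t w =
     (\<lambda>lam\<in>cores CARD('s).
        THE mu. is_partition mu \<and> beta_set mu = level_action TYPE('s) t w ` beta_set lam)"

definition core_stabilizer ::
    "'s::nontriv itself \<Rightarrow> nat \<Rightarrow> (nat \<Rightarrow> nat) \<Rightarrow> (int \<Rightarrow> int) monoid" where
  "core_stabilizer TYPE('s) t lam =
     (affine_sym CARD('s))
       \<lparr>carrier := stabilizer (affine_sym CARD('s)) (core_action TYPE('s) t) lam\<rparr>"

definition s_set :: "'s::nontriv itself \<Rightarrow> (nat \<Rightarrow> nat) \<Rightarrow> int set" where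
  "s_set TYPE('s) lam =
     (\<lambda>i::'s mod_ring. LEAST a. a \<in> residue_class i \<and> a \<notin> beta_set lam) ` UNIV"

definition core_point :: "(nat \<Rightarrow> nat) \<Rightarrow> real ^ ('s::nontriv mod_ring)" where
  "core_point lam = (\<chi> i. of_int (THE a. a \<in> s_set TYPE('s) lam \<inter> residue_class i))"

definition sum_space :: "(real ^ ('s::nontriv mod_ring)) set" where
  "sum_space = {x. (\<Sum>i\<in>UNIV. vec_nth x i) = real (CARD('s) choose 2)}"

definition wall :: "nat \<Rightarrow> 's::nontriv mod_ring \<Rightarrow> (real ^ 's mod_ring) set" where
  "wall t j = {x \<in> sum_space. vec_nth x j - vec_nth x (j - of_nat t) = real t}"

text \<open>
  \<open>wall t j\<close> is an affine hyperplane of \<open>sum_space\<close>, so its closest-point map is the orthogonal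
  projection onto it and the reflection sends \<open>x\<close> to \<open>p + (p - x)\<close>, where \<open>p\<close> is the projection
  of \<open>x\<close>.
\<close>

definition wall_reflection ::
    "nat \<Rightarrow> 's::nontriv mod_ring \<Rightarrow> real ^ ('s mod_ring) \<Rightarrow> real ^ ('s mod_ring)" where
  "wall_reflection t j = (\<lambda>x\<in>sum_space. 2 *\<^sub>R closest_point (wall t j) x - x)"

definition reflection_group ::
    "'s::nontriv itself \<Rightarrow> nat \<Rightarrow> (nat \<Rightarrow> nat)
      \<Rightarrow> (real ^ ('s mod_ring) \<Rightarrow> real ^ ('s mod_ring)) monoid" where
  "reflection_group TYPE('s) t lam =
     subgroup_generated (BijGroup sum_space)
       {wall_reflection t j | j. core_point lam \<in> wall t j}"

end

theory Submission
  imports Defs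
begin

text \<open>
  The theorem is an instance of the fact that the stabiliser of a point of a closed alcove in an affine
  Weyl group is generated by the reflections in the walls of the alcove through that point.

  Order the residues modulo \<open>s\<close> as \<open>k t - s \<circ> t\<close> with \<open>k\<close> an integer. In this coordinate the
  level \<open>t\<close> action of \<open>w\<close> is \<open>k \<mapsto> w k\<close> on residues, with an integer in the class of \<open>k\<close> being displaced by
  \<open>t (w k - k)\<close> (\<open>level_perm\<close>). A point \<open>x\<close> of \<open>sum_space\<close> is recorded by its unrolled sequence
  \<open>X k = x\<^sub>k - t k\<close>, where \<open>x\<^sub>k\<close> is the coordinate at the class of \<open>k\<close>. The affine symmetric group acts on
  these sequences by \<open>X \<mapsto> X \<circ> w\<inverse>\<close>. This action on \<open>sum_space\<close> is faithful (\<open>geometric_action_inj\<close>),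
  its generators act as the reflections in the walls (\<open>geometric_action_gen\<close>), and a point lies on the wall
  belonging to \<open>k + 1\<close> iff \<open>X (k + 1) = X k\<close>.

  For an \<open>s\<close>-core the beta-set is an abacus with runners of period \<open>s\<close>, determined by its
  \<open>s\<close>-set. So \<open>w\<close> fixes the core iff it preserves the \<open>s\<close>-set, and this means \<open>X \<circ> w = X\<close> for the
  sequence \<open>X\<close> of the core point (\<open>stabilizer_unrolled\<close>). That the image of a beta-set is again
  one, and that the core point lies in \<open>sum_space\<close>, are both the statement that charge
  zero is the equation of \<open>sum_space\<close> for the \<open>s\<close>-set (\<open>abacus_balanced_iff\<close>).

  If the core is also a \<open>t\<close>-core, \<open>X\<close> is weakly decreasing (\<open>core_point_antimono\<close>). A descent of a
  permutation \<open>w\<close> with \<open>X \<circ> w = X\<close> forces \<open>X\<close> to be constant across it, so the generator undoing the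
  descent also stabilises \<open>X\<close>. By induction, the stabiliser is generated by the generators that it
  contains (\<open>antimono_stabilizer_generated\<close>). The faithful geometric action maps these
  onto the reflections in the walls through the core point, and so restricts to the required isomorphism.
\<close>

section \<open>The affine symmetric group\<close>

lemma sum_int_interval: "(\<Sum>m\<in>{0..<int s}. m) = int (s choose 2)"
proof (induction s)
  case (Suc s)
  have "{0..<int (Suc s)} = insert (int s) {0..<int s}" by auto
  with Suc show ?case by (simp add: numeral_2_eq_2)
qed simp

text \<open>
  Since \<open>0 + \<dots> + (s - 1)\<close> is the prescribed sum, the normalisation says that the displacements
  \<open>w m - m\<close> cancel over a period. The displacement is periodic, which makes this form the convenient one.
\<close>

lemma affine_sym_iff:
  "w \<in> carrier (affine_sym s) \<longleftrightarrow>
     bij w \<and> (\<forall>m. w (m + int s) = w m + int s) \<and> (\<Sum>m\<in>{0..<int s}. w m - m) = 0"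
  by (simp add: affine_sym_def sum_subtractf sum_int_interval)

lemma shift_multiple:
  fixes w :: "int \<Rightarrow> 'a::comm_ring_1"
  assumes "\<And>m. w (m + int s) = w m + d"
  shows "w (m + k * int s) = w m + of_int k * d"
proof (induction k rule: int_induct[of _ 0])
  case (step1 i)
  then show ?case using assms[of "m + i * int s"] by (simp add: algebra_simps)
next
  case (step2 i)
  then show ?case using assms[of "m + (i - 1) * int s"] by (simp add: algebra_simps)
qed simp

text \<open>
  After a linear correction a map that is equivariant for the shift by \<open>s\<close> depends only on residues.
  This covers the displacements of affine permutations (\<open>c = 1\<close>), the unrolled points of the
  geometric part (\<open>c = - t\<close>) and periodic functions (\<open>c = 0\<close>).
\<close>

lemma shift_cong:
  fixes w :: "int \<Rightarrow> 'a::comm_ring_1"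
  assumes "\<And>m. w (m + int s) = w m + of_int c * of_nat s" "k mod int s = l mod int s"
  shows "w k - of_int c * of_int k = w l - of_int c * of_int l"
proof -
  from assms(2) obtain q where "k = l + q * int s"
    by (metis mod_eqE mult.commute)
  then show ?thesis using shift_multiple[of w s "of_int c * of_nat s" l q, OF assms(1)]
    by (simp add: algebra_simps)
qed

lemma periodic_cong:
  fixes f :: "int \<Rightarrow> 'a::comm_ring_1"
  assumes "\<And>m. f (m + int s) = f m" "k mod int s = l mod int s"
  shows "f k = f l"
  using shift_cong[of f s 0 k l] assms by simp

text \<open>
  A permutation commuting with the shift by \<open>s\<close> permutes the residues modulo \<open>s\<close>, so it does
  not change the sum of an \<open>s\<close>-periodic function over one period.
\<close>

lemma sum_period_reindex:
  fixes f :: "int \<Rightarrow> 'a::comm_ring_1"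
  assumes "0 < s" and f: "\<And>m. f (m + int s) = f m"
    and w: "bij w" "\<And>m. w (m + int s) = w m + int s"
  shows "(\<Sum>m\<in>{0..<int s}. f (w m)) = (\<Sum>m\<in>{0..<int s}. f m)"
proof -
  let ?r = "\<lambda>m. w m mod int s"
  have "inj_on ?r {0..<int s}"
  proof (rule inj_onI)
    fix m m' assume m: "m \<in> {0..<int s}" "m' \<in> {0..<int s}" and "w m mod int s = w m' mod int s"
    then obtain q where "w m = w m' + q * int s"
      by (metis mod_eqE mult.commute)
    also have "\<dots> = w (m' + q * int s)"
      using shift_multiple[of w s "int s" m' q] w(2) by simp
    finally have "m = m' + q * int s"
      using w(1) by (simp add: bij_def inj_eq)
    then have "m mod int s = m' mod int s" by simp
    with m show "m = m'" by simp
  qed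
  moreover have "?r ` {0..<int s} \<subseteq> {0..<int s}" using \<open>0 < s\<close> by auto
  ultimately have "bij_betw ?r {0..<int s} {0..<int s}"
    by (simp add: bij_betw_def endo_inj_surj)
  then have "(\<Sum>m\<in>{0..<int s}. f (?r m)) = (\<Sum>m\<in>{0..<int s}. f m)"
    by (rule sum.reindex_bij_betw)
  moreover have "f (?r m) = f (w m)" for m
    by (rule periodic_cong[of f s]) (simp_all add: f)
  ultimately show ?thesis by simp
qed

lemma affine_sym_comp:
  assumes "0 < s" "v \<in> carrier (affine_sym s)" "w \<in> carrier (affine_sym s)"
  shows "v \<circ> w \<in> carrier (affine_sym s)"
proof -
  have "(\<Sum>m\<in>{0..<int s}. v (w m) - w m) = (\<Sum>m\<in>{0..<int s}. v m - m)"
    using assms by (intro sum_period_reindex[of s "\<lambda>m. v m - m"]) (auto simp: affine_sym_iff)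
  then have "(\<Sum>m\<in>{0..<int s}. (v (w m) - w m) + (w m - m)) = 0"
    using assms by (simp only: sum.distrib) (simp add: affine_sym_iff)
  with assms show ?thesis by (auto simp: affine_sym_iff bij_comp)
qed

lemma affine_sym_inv:
  assumes "0 < s" "w \<in> carrier (affine_sym s)"
  shows "inv_into UNIV w \<in> carrier (affine_sym s)"
proof -
  let ?v = "inv_into UNIV w"
  from assms have w: "bij w" "\<And>m. w (m + int s) = w m + int s" by (auto simp: affine_sym_iff)
  then have wv: "w (?v m) = m" and vw: "?v (w m) = m" for m
    by (auto simp: bij_def surj_f_inv_f)
  have v: "bij ?v" by (rule bij_imp_bij_inv[OF w(1)])
  have sh: "?v (m + int s) = ?v m + int s" for m
    using vw[of "?v m + int s"] w(2)[of "?v m"] wv[of m] by simp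
  have "(\<Sum>m\<in>{0..<int s}. w (?v m) - ?v m) = (\<Sum>m\<in>{0..<int s}. w m - m)"
    using assms v sh by (intro sum_period_reindex[of s "\<lambda>m. w m - m"]) (auto simp: affine_sym_iff)
  then have "(\<Sum>m\<in>{0..<int s}. - (m - ?v m)) = 0"
    using assms by (simp add: wv affine_sym_iff sum_negf del: minus_diff_eq)
  with v sh show ?thesis by (simp add: affine_sym_iff)
qed

lemma affine_sym_mult:
  assumes "v \<in> carrier (affine_sym s)" "w \<in> carrier (affine_sym s)"
  shows "v \<otimes>\<^bsub>affine_sym s\<^esub> w = v \<circ> w"
  using assms by (simp add: affine_sym_def BijGroup_def Bij_def compose_def comp_def restrict_def)

lemma affine_sym_one: "\<one>\<^bsub>affine_sym s\<^esub> = id"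
  by (auto simp: affine_sym_def BijGroup_def)

lemma id_affine_sym: "id \<in> carrier (affine_sym s)"
  by (simp add: affine_sym_iff)

lemma group_affine_sym:
  assumes "0 < s"
  shows "group (affine_sym s)"
proof (rule groupI)
  fix w assume w: "w \<in> carrier (affine_sym s)"
  show "\<exists>v\<in>carrier (affine_sym s). v \<otimes>\<^bsub>affine_sym s\<^esub> w = \<one>\<^bsub>affine_sym s\<^esub>"
    using affine_sym_inv[OF assms w] w
    by (intro bexI[of _ "inv_into UNIV w"])
       (auto simp: affine_sym_mult affine_sym_one affine_sym_iff bij_def)
qed (auto simp: assms affine_sym_comp affine_sym_mult affine_sym_one id_affine_sym comp_assoc)

lemma affine_sym_m_inv:
  assumes "0 < s" "w \<in> carrier (affine_sym s)"
  shows "inv\<^bsub>affine_sym s\<^esub> w = inv_into UNIV w"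
proof -
  interpret group "affine_sym s" by (rule group_affine_sym[OF assms(1)])
  have "inv_into UNIV w \<otimes>\<^bsub>affine_sym s\<^esub> w = \<one>\<^bsub>affine_sym s\<^esub>"
    using affine_sym_inv[OF assms] assms(2)
    by (auto simp: affine_sym_mult affine_sym_one affine_sym_iff bij_def)
  then show ?thesis using affine_sym_inv[OF assms] assms(2) by (simp add: inv_equality)
qed

section \<open>Residue classes along multiples of the level\<close>

text \<open>
  The level \<open>t\<close> generators exchange neighbouring members of the sequence \<open>k t - s \<circ> t\<close> of residues, where
  the usual generators exchange neighbouring integers \<open>k\<close>. As \<open>t\<close> is invertible modulo \<open>s\<close>, this
  sequence runs through all residues with period \<open>s\<close>, so \<open>k\<close> serves as a coordinate on
  \<open>\<int>/s\<int>\<close> in which the level \<open>t\<close> structure looks like the level \<open>1\<close> structure.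
\<close>

definition level_class :: "nat \<Rightarrow> int \<Rightarrow> 's::nontriv mod_ring" where
  "level_class t k = of_int k * of_nat t - of_int (circ CARD('s) t)"

definition level_index :: "nat \<Rightarrow> 's::nontriv mod_ring \<Rightarrow> int" where
  "level_index t j = (SOME k. level_class t k = j)"

lemma of_int_mod_ring_eq_iff:
  "(of_int a :: 's::nontriv mod_ring) = of_int b \<longleftrightarrow> a mod int CARD('s) = b mod int CARD('s)"
  by (simp add: of_int_of_int_mod_ring) (transfer, simp)

lemma surj_of_int_mod_ring: "\<exists>m. (of_int m :: 's::nontriv mod_ring) = j"
  by (metis of_int_of_int_mod_ring of_int_mod_ring_to_int_mod_ring)

lemma card_nontriv: "2 \<le> CARD('s::nontriv)"
  using nontriv[where 'a='s] by linarith

lemma level_class_shift: "level_class t (k + 1) = level_class t k + (of_nat t :: 's::nontriv mod_ring)"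
  by (simp add: level_class_def algebra_simps)

lemma level_class_one: "level_class 1 k = (of_int k :: 's::nontriv mod_ring)"
  by (simp add: level_class_def circ_def)

lemma level_class_eq_iff:
  assumes "coprime CARD('s::nontriv) t"
  shows "(level_class t k :: 's mod_ring) = level_class t l \<longleftrightarrow> k mod int CARD('s) = l mod int CARD('s)"
proof -
  have "(level_class t k :: 's mod_ring) = level_class t l \<longleftrightarrow>
      (of_int (k * int t) :: 's mod_ring) = of_int (l * int t)"
    by (simp add: level_class_def)
  also have "\<dots> \<longleftrightarrow> [k * int t = l * int t] (mod int CARD('s))"
    by (simp add: of_int_mod_ring_eq_iff cong_def del: of_int_mult)
  also have "\<dots> \<longleftrightarrow> [k = l] (mod int CARD('s))"
    using assms by (intro cong_mult_rcancel) (simp add: coprime_commute)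
  finally show ?thesis by (simp add: cong_def)
qed

lemma surj_level_class:
  assumes "coprime CARD('s::nontriv) t"
  shows "\<exists>k. level_class t k = (j :: 's mod_ring)"
proof -
  obtain m where m: "(of_int m :: 's mod_ring) = j" using surj_of_int_mod_ring by blast
  obtain u where "[int t * u = 1] (mod int CARD('s))"
    using cong_solve_coprime_int[of "int t" "int CARD('s)"] assms by (auto simp: coprime_commute)
  then have u: "(of_nat t * of_int u :: 's mod_ring) = 1"
    using of_int_mod_ring_eq_iff[of "int t * u" 1, where 's='s] by (simp add: cong_def)
  have "level_class t (u * (m + circ CARD('s) t)) = (of_nat t * of_int u) * (j + of_int (circ CARD('s) t))
     - (of_int (circ CARD('s) t) :: 's mod_ring)"
    by (simp add: level_class_def m algebra_simps)
  then have "level_class t (u * (m + circ CARD('s) t)) = j" by (simp add: u)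
  then show ?thesis by blast
qed

lemma level_class_index:
  assumes "coprime CARD('s::nontriv) t"
  shows "level_class t (level_index t j) = (j :: 's mod_ring)"
  unfolding level_index_def by (rule someI_ex) (rule surj_level_class[OF assms])

lemma sum_level_class:
  assumes "coprime CARD('s::nontriv) t"
  shows "(\<Sum>k\<in>{0..<int CARD('s)}. f (level_class t k :: 's mod_ring)) = (\<Sum>j\<in>UNIV. f j)"
proof -
  have "inj_on (level_class t :: int \<Rightarrow> 's mod_ring) {0..<int CARD('s)}"
    by (auto simp: inj_on_def level_class_eq_iff[OF assms])
  moreover have "level_class t ` {0..<int CARD('s)} = (UNIV :: 's mod_ring set)"
  proof (intro equalityI subsetI UNIV_I)
    fix j :: "'s mod_ring"
    obtain k where "level_class t k = j" using surj_level_class[OF assms] by blast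
    then have "j = level_class t (k mod int CARD('s))"
      using level_class_eq_iff[OF assms, of k "k mod int CARD('s)"] by simp
    then show "j \<in> level_class t ` {0..<int CARD('s)}" using card_nontriv[where 's='s] by simp
  qed
  ultimately have "bij_betw (level_class t) {0..<int CARD('s)} (UNIV :: 's mod_ring set)"
    by (simp add: bij_betw_def)
  then show ?thesis by (rule sum.reindex_bij_betw)
qed

lemma sum_residues:
  "(\<Sum>k\<in>{0..<int CARD('s::nontriv)}. f (of_int k :: 's mod_ring)) = (\<Sum>j\<in>UNIV. f j)"
  using sum_level_class[of 1 f] by (simp add: level_class_one del: One_nat_def)

section \<open>Generators of the stabiliser of a monotone sequence\<close>

lemma affine_gen_apply:
  "affine_gen (i :: 's::nontriv mod_ring) m =
     (if of_int m = i - 1 then m + 1 else if of_int m = i then m - 1 else m)"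
  by (simp add: affine_gen_def residue_class_def)

lemma affine_gen_involution: "affine_gen (i :: 's::nontriv mod_ring) (affine_gen i m) = m"
  by (auto simp: affine_gen_apply)

lemma affine_gen_in_affine_sym: "affine_gen (i :: 's::nontriv mod_ring) \<in> carrier (affine_sym CARD('s))"
proof -
  have "bij (affine_gen i)" by (rule o_bij[of "affine_gen i"]) (auto simp: affine_gen_involution)
  moreover have "(\<Sum>m\<in>{0..<int CARD('s)}. affine_gen i m - m) =
     (\<Sum>m\<in>{0..<int CARD('s)}. (\<lambda>j. (if j = i - 1 then 1 else 0) - (if j = i then 1 else 0)) (of_int m))"
    by (rule sum.cong) (auto simp: affine_gen_apply)
  moreover have "\<dots> = 0"
    by (subst sum_residues) (simp add: sum_subtractf)
  ultimately show ?thesis by (simp add: affine_sym_iff affine_gen_apply)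
qed

text \<open>
  The energy is the termination measure for writing \<open>w\<close> as a word in the generators: a non-negative
  integer that drops whenever a descent of \<open>w\<close> is undone.
\<close>

definition energy :: "nat \<Rightarrow> (int \<Rightarrow> int) \<Rightarrow> int" where
  "energy s w = (\<Sum>m\<in>{0..<int s}. (w m - m)\<^sup>2)"

text \<open>
  Composing with the generator that exchanges \<open>k\<close> and \<open>k + 1\<close> replaces the displacements \<open>d\<close> and \<open>e\<close> at \<open>k\<close> and \<open>k + 1\<close> by
  \<open>e + 1\<close> and \<open>d - 1\<close>. This changes the sum of squares by \<open>2 (1 - (d - e))\<close>, and a descent
  means \<open>d - e \<ge> 2\<close>.
\<close>

lemma energy_descent:
  assumes w: "w \<in> carrier (affine_sym CARD('s))" and desc: "w (k + 1) < w k"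
  shows "energy CARD('s) (w \<circ> affine_gen (of_int (k + 1) :: 's::nontriv mod_ring)) < energy CARD('s) w"
proof -
  let ?g = "affine_gen (of_int (k + 1) :: 's mod_ring)"
  let ?c = "\<lambda>j :: 's mod_ring. if j = of_int k then 1 - 2 * (w k - k) else 0"
  let ?d = "\<lambda>j :: 's mod_ring. if j = of_int (k + 1) then 1 + 2 * (w (k + 1) - (k + 1)) else 0"
  have w': "\<And>m. w (m + int CARD('s)) = w m + int CARD('s)" using w by (simp add: affine_sym_iff)
  have g: "bij ?g" "\<And>m. ?g (m + int CARD('s)) = ?g m + int CARD('s)"
    using affine_gen_in_affine_sym[of "of_int (k + 1) :: 's mod_ring"] by (auto simp: affine_sym_iff)
  have d: "w m - m = w l - l" if "(of_int m :: 's mod_ring) = of_int l" for m l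
    using shift_cong[of w "CARD('s)" 1 m l] w' that by (simp add: of_int_mod_ring_eq_iff)
  have "energy CARD('s) (w \<circ> ?g) = (\<Sum>m\<in>{0..<int CARD('s)}. (\<lambda>m. (w m - ?g m)\<^sup>2) (?g m))"
    by (simp add: energy_def affine_gen_involution)
  also have "\<dots> = (\<Sum>m\<in>{0..<int CARD('s)}. (w m - ?g m)\<^sup>2)"
    by (rule sum_period_reindex) (use g w' in auto)
  also have "\<dots> = (\<Sum>m\<in>{0..<int CARD('s)}. (w m - m)\<^sup>2 + (?c (of_int m) + ?d (of_int m)))"
  proof (rule sum.cong[OF refl])
    fix m
    consider (l) "(of_int m :: 's mod_ring) = of_int k" | (r) "(of_int m :: 's mod_ring) = of_int (k + 1)"
      | (n) "(of_int m :: 's mod_ring) \<noteq> of_int k" "(of_int m :: 's mod_ring) \<noteq> of_int (k + 1)" by blast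
    then show "(w m - ?g m)\<^sup>2 = (w m - m)\<^sup>2 + (?c (of_int m) + ?d (of_int m))"
    proof cases
      case l
      then have "?g m = m + 1" by (simp add: affine_gen_apply)
      with l d[OF l] show ?thesis by (simp add: power2_eq_square algebra_simps)
    next
      case r
      then have "?g m = m - 1" by (simp add: affine_gen_apply)
      moreover have "?c (of_int m) = 0" using r by simp
      moreover have "?d (of_int m) = 1 + 2 * (w m - m)" using r d[OF r] by simp
      ultimately show ?thesis by (simp only: power2_eq_square) (simp add: algebra_simps)
    next
      case n
      then show ?thesis by (simp add: affine_gen_apply)
    qed
  qed
  also have "\<dots> = energy CARD('s) w + ((\<Sum>m\<in>{0..<int CARD('s)}. ?c (of_int m)) + (\<Sum>m\<in>{0..<int CARD('s)}. ?d (of_int m)))"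
    by (simp only: sum.distrib energy_def)
  also have "(\<Sum>m\<in>{0..<int CARD('s)}. ?c (of_int m)) = 1 - 2 * (w k - k)"
    by (subst sum_residues) simp
  also have "(\<Sum>m\<in>{0..<int CARD('s)}. ?d (of_int m)) = 1 + 2 * (w (k + 1) - (k + 1))"
    by (subst sum_residues) simp
  finally have eq: "energy CARD('s) (w \<circ> ?g) = energy CARD('s) w +
    (1 - 2 * (w k - k) + (1 + 2 * (w (k + 1) - (k + 1))))" .
  show ?thesis unfolding eq using desc by simp
qed

text \<open>
  An increasing bijection of the integers is a translation, and the normalisation of the sum
  excludes every translation but the identity.
\<close>

lemma affine_sym_no_descent:
  assumes w: "w \<in> carrier (affine_sym s)" and "0 < s" and asc: "\<And>k. w k < w (k + 1)"
  shows "w = id"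
proof -
  have mono: "w k < w l" if "k < l" for k l
    using that by (induction l rule: int_gr_induct) (use asc less_trans in blast)+
  have step: "w (k + 1) = w k + 1" for k
  proof -
    obtain x where x: "w x = w k + 1" using w unfolding affine_sym_iff bij_def surj_def by metis
    then have "k < x" using mono[of x k] by (metis less_irrefl linorder_neqE less_add_one order_less_trans)
    then have "w (k + 1) \<le> w x" using mono[of "k + 1" x] by (cases "x = k + 1") auto
    with x asc[of k] show ?thesis by linarith
  qed
  have w0: "w k = w 0 + k" for k
    using shift_multiple[of w 1 1 0 k] step by simp
  have "w m - m = w 0" for m using w0[of m] by linarith
  then have "(\<Sum>m\<in>{0..<int s}. w m - m) = int s * w 0" by simp
  with w \<open>0 < s\<close> have "w 0 = 0" by (simp add: affine_sym_iff)
  then show ?thesis using w0 by (intro ext) (metis add_0 id_apply)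
qed

lemma stabilizer_subgroup:
  assumes "0 < s"
  shows "subgroup {w \<in> carrier (affine_sym s). n \<circ> w = n} (affine_sym s)"
proof -
  interpret group "affine_sym s" by (rule group_affine_sym[OF assms])
  show ?thesis
  proof (rule subgroupI)
    fix w assume "w \<in> {w \<in> carrier (affine_sym s). n \<circ> w = n}"
    then have w: "w \<in> carrier (affine_sym s)" "n \<circ> w = n" by auto
    have "n \<circ> inv_into UNIV w = (n \<circ> w) \<circ> inv_into UNIV w" by (simp only: w)
    also have "\<dots> = n" using w(1) by (auto simp: affine_sym_iff bij_def surj_f_inv_f)
    finally show "inv\<^bsub>affine_sym s\<^esub> w \<in> {w \<in> carrier (affine_sym s). n \<circ> w = n}"
      using w assms by (simp add: affine_sym_m_inv affine_sym_inv)
  next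
    fix v w assume "v \<in> {w \<in> carrier (affine_sym s). n \<circ> w = n}" "w \<in> {w \<in> carrier (affine_sym s). n \<circ> w = n}"
    then show "v \<otimes>\<^bsub>affine_sym s\<^esub> w \<in> {w \<in> carrier (affine_sym s). n \<circ> w = n}"
      using assms by (simp add: affine_sym_mult affine_sym_comp comp_assoc[symmetric])
  next
    have "id \<in> {w \<in> carrier (affine_sym s). n \<circ> w = n}" by (simp add: id_affine_sym)
    then show "{w \<in> carrier (affine_sym s). n \<circ> w = n} \<noteq> {}" by blast
  qed auto
qed

text \<open>
  If \<open>w\<close> preserves the weakly decreasing sequence \<open>n\<close> and has a descent \<open>w (k + 1) < w k\<close>, then
  \<open>n k = n (w k) \<le> n (w (k + 1)) = n (k + 1) \<le> n k\<close>. So the generator that exchanges \<open>k\<close> and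
  \<open>k + 1\<close> preserves \<open>n\<close> as well and can be split off from \<open>w\<close>, which lowers the energy. This is the
  combinatorial form of the theorem that the stabiliser of a point of a closed alcove is generated by
  the reflections in the walls through it; a constant \<open>n\<close> gives the generation of the whole group.
\<close>

lemma antimono_stabilizer_generated:
  fixes n :: "int \<Rightarrow> 'a::linordered_idom"
  assumes anti: "\<And>k. n (k + 1) \<le> n k"
    and shift: "\<And>k. n (k + int CARD('s)) = n k + d"
  shows "{w \<in> carrier (affine_sym CARD('s::nontriv)). n \<circ> w = n} =
     generate (affine_sym CARD('s)) {affine_gen i | i :: 's mod_ring. n \<circ> affine_gen i = n}"
    (is "?S = generate ?G ?K")
proof
  have s: "0 < CARD('s)" by simp
  interpret group ?G by (rule group_affine_sym[OF s])
  show "generate ?G ?K \<subseteq> ?S"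
    by (rule generate_subgroup_incl[OF _ stabilizer_subgroup[OF s]])
       (auto simp: affine_gen_in_affine_sym)
  have le: "n l \<le> n k" if "k \<le> l" for k l
    using that by (induction l rule: int_ge_induct) (use anti order_trans in blast)+
  have "w \<in> generate ?G ?K" if "w \<in> ?S" for w
    using that
  proof (induction "nat (energy CARD('s) w)" arbitrary: w rule: less_induct)
    case less
    then have w: "w \<in> carrier ?G" and nw: "\<And>k. n (w k) = n k" by (auto simp: fun_eq_iff)
    show ?case
    proof (cases "\<forall>k. w k < w (k + 1)")
      case True
      then have "w = id" using affine_sym_no_descent[OF w s] by blast
      then show ?thesis using generate.one[of ?G ?K] by (simp add: affine_sym_one)
    next
      case False
      then obtain k where "w (k + 1) \<le> w k" by (meson not_less)
      moreover have "w (k + 1) \<noteq> w k" using w by (auto simp: affine_sym_iff bij_def dest: injD)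
      ultimately have desc: "w (k + 1) < w k" by simp
      let ?g = "affine_gen (of_int (k + 1) :: 's mod_ring)"
      have eq: "n (k + 1) = n k"
        using le[of "w (k + 1)" "w k"] desc anti[of k] nw by (simp add: antisym)
      have same: "n (l + 1) = n l" if "(of_int l :: 's mod_ring) = of_int k" for l
      proof -
        from that have "l mod int CARD('s) = k mod int CARD('s)" by (simp add: of_int_mod_ring_eq_iff)
        then obtain q where q: "l = k + q * int CARD('s)" by (metis mod_eqE mult.commute)
        then have "l + 1 = (k + 1) + q * int CARD('s)" by simp
        then have "l + 1 = k + 1 + q * int CARD('s)" by simp
        then have "n (l + 1) = n (k + 1) + of_int q * d"
          by (simp only: shift_multiple[of n "CARD('s)" d "k + 1" q, OF shift])
        also have "\<dots> = n l"
          using q eq shift_multiple[of n "CARD('s)" d k q, OF shift] by simp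
        finally show ?thesis .
      qed
      have "n (?g m) = n m" for m
      proof -
        consider (l) "(of_int m :: 's mod_ring) = of_int k" | (r) "(of_int (m - 1) :: 's mod_ring) = of_int k"
          | (n) "(of_int m :: 's mod_ring) \<noteq> of_int k" "(of_int m :: 's mod_ring) \<noteq> of_int (k + 1)" 
          by fastforce
        then show ?thesis
        proof cases
          case l
          then show ?thesis using same[OF l] by (simp add: affine_gen_apply)
        next
          case r
          then have "?g m = m - 1" by (simp add: affine_gen_apply algebra_simps)
          then show ?thesis using same[OF r] by simp
        qed (simp add: affine_gen_apply)
      qed
      then have g: "?g \<in> ?K" by (auto simp: fun_eq_iff)
      have "energy CARD('s) w \<ge> 0" by (simp add: energy_def sum_nonneg)
      with energy_descent[OF w desc] have "nat (energy CARD('s) (w \<circ> ?g)) < nat (energy CARD('s) w)"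
        by (smt (verit) nat_less_eq_zless nat_less_iff energy_def sum_nonneg zero_le_power2)
      moreover have "w \<circ> ?g \<in> ?S"
        using less.prems g affine_sym_comp[OF s w affine_gen_in_affine_sym] by (auto simp: comp_assoc[symmetric])
      ultimately have "w \<circ> ?g \<in> generate ?G ?K" by (rule less.hyps)
      then have "(w \<circ> ?g) \<otimes>\<^bsub>?G\<^esub> ?g \<in> generate ?G ?K"
        using generate.incl[OF g] by (rule generate.eng)
      moreover have "(w \<circ> ?g) \<otimes>\<^bsub>?G\<^esub> ?g = w"
        using affine_sym_comp[OF s w affine_gen_in_affine_sym]
        by (auto simp: affine_sym_mult affine_gen_in_affine_sym affine_gen_involution)
      ultimately show ?thesis by simp
    qed
  qed
  then show "?S \<subseteq> generate ?G ?K" by blast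
qed

section \<open>The level action\<close>

lemma affine_sym_generated:
  "generate (affine_sym CARD('s::nontriv)) (range (affine_gen :: 's mod_ring \<Rightarrow> _)) = carrier (affine_sym CARD('s))"
  using antimono_stabilizer_generated[of "\<lambda>_. 0 :: int" 0, where 's='s]
  by (simp add: full_SetCompr_eq comp_def)

text \<open>
  In the description \<open>m = k t - s \<circ> t + n s\<close> of an integer, the level \<open>t\<close> action is \<open>w\<close> acting on \<open>k\<close>
  alone. The pair \<open>(k, n)\<close> is only determined up to multiples of \<open>(s, - t)\<close>, and
  \<open>w (k + s) = w k + s\<close> makes the choice of \<open>k\<close> irrelevant.
\<close>

definition level_perm :: "'s::nontriv itself \<Rightarrow> nat \<Rightarrow> (int \<Rightarrow> int) \<Rightarrow> int \<Rightarrow> int" where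
  "level_perm TYPE('s) t w m =
     (let k = level_index t (of_int m :: 's mod_ring) in m + int t * (w k - k))"

lemma level_perm_apply:
  assumes "coprime CARD('s::nontriv) t" "w \<in> carrier (affine_sym CARD('s))"
    and "(of_int m :: 's mod_ring) = level_class t k"
  shows "level_perm TYPE('s) t w m = m + int t * (w k - k)"
proof -
  let ?i = "level_index t (of_int m :: 's mod_ring)"
  have "(level_class t ?i :: 's mod_ring) = level_class t k"
    using assms(3) by (simp add: level_class_index[OF assms(1)])
  then have "w ?i - ?i = w k - k"
    using shift_cong[of w "CARD('s)" 1 ?i k] assms(2)
    by (simp add: level_class_eq_iff[OF assms(1)] affine_sym_iff)
  then show ?thesis by (simp add: level_perm_def)
qed

lemma level_perm_class:
  assumes "coprime CARD('s::nontriv) t" "w \<in> carrier (affine_sym CARD('s))"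
    and "(of_int m :: 's mod_ring) = level_class t k"
  shows "(of_int (level_perm TYPE('s) t w m) :: 's mod_ring) = level_class t (w k)"
  by (simp add: level_perm_apply[OF assms] assms(3) level_class_def algebra_simps)

lemma level_perm_comp:
  assumes cop: "coprime CARD('s::nontriv) t"
    and v: "v \<in> carrier (affine_sym CARD('s))" and w: "w \<in> carrier (affine_sym CARD('s))"
  shows "level_perm TYPE('s) t (v \<circ> w) = level_perm TYPE('s) t v \<circ> level_perm TYPE('s) t w"
proof
  fix m
  obtain k where k: "(of_int m :: 's mod_ring) = level_class t k"
    using surj_level_class[OF cop] by metis
  have "v \<circ> w \<in> carrier (affine_sym CARD('s))" by (rule affine_sym_comp[OF _ v w]) simp
  then have "level_perm TYPE('s) t (v \<circ> w) m = m + int t * (v (w k) - k)"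
    by (simp add: level_perm_apply[OF cop _ k])
  also have "\<dots> = level_perm TYPE('s) t v (level_perm TYPE('s) t w m)"
    unfolding level_perm_apply[OF cop v level_perm_class[OF cop w k]]
    unfolding level_perm_apply[OF cop w k]
    by (simp add: algebra_simps)
  finally show "level_perm TYPE('s) t (v \<circ> w) m = (level_perm TYPE('s) t v \<circ> level_perm TYPE('s) t w) m"
    by simp
qed

lemma level_perm_id: "level_perm TYPE('s::nontriv) t id = id"
  by (auto simp: level_perm_def Let_def)

lemma bij_level_perm:
  assumes cop: "coprime CARD('s::nontriv) t" and w: "w \<in> carrier (affine_sym CARD('s))"
  shows "bij (level_perm TYPE('s) t w)"
proof -
  have v: "inv_into UNIV w \<in> carrier (affine_sym CARD('s))" by (rule affine_sym_inv[OF _ w]) simp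
  have eq: "inv_into UNIV w \<circ> w = id" "w \<circ> inv_into UNIV w = id"
    using w by (auto simp: affine_sym_iff bij_def surj_iff)
  show ?thesis
    using level_perm_comp[OF cop v w] level_perm_comp[OF cop w v]
    by (intro o_bij[of "level_perm TYPE('s) t (inv_into UNIV w)"]) (simp_all add: eq level_perm_id)
qed

lemma level_perm_gen:
  assumes cop: "coprime CARD('s::nontriv) t"
  shows "level_perm TYPE('s) t (affine_gen i) = level_gen t (i :: 's mod_ring)"
proof
  fix m
  obtain k where k: "(of_int m :: 's mod_ring) = level_class t k"
    using surj_level_class[OF cop] by metis
  have iff: "m \<in> residue_class (j * of_nat t - of_int (circ CARD('s) t)) \<longleftrightarrow> of_int k = j" for j :: "'s mod_ring"
  proof -
    obtain l where l: "of_int l = j" using surj_of_int_mod_ring by blast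
    have "m \<in> residue_class (j * of_nat t - of_int (circ CARD('s) t)) \<longleftrightarrow>
        (level_class t k :: 's mod_ring) = level_class t l"
      by (simp add: residue_class_def k) (simp add: level_class_def l)
    also have "\<dots> \<longleftrightarrow> (of_int k :: 's mod_ring) = of_int l"
      by (simp add: level_class_eq_iff[OF cop] of_int_mod_ring_eq_iff)
    finally show ?thesis by (simp add: l)
  qed
  show "level_perm TYPE('s) t (affine_gen i) m = level_gen t i m"
    by (simp add: level_perm_apply[OF cop affine_gen_in_affine_sym k] level_gen_def iff affine_gen_apply)
qed

lemma group_hom_eq_on_generate:
  assumes f: "group_hom G H f" and g: "group_hom G H g"
    and K: "K \<subseteq> carrier G" "\<And>x. x \<in> K \<Longrightarrow> f x = g x" and x: "x \<in> generate G K"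
  shows "f x = g x"
proof -
  interpret f: group_hom G H f by fact
  interpret g: group_hom G H g by fact
  show ?thesis using x
  proof (induction rule: generate.induct)
    case (inv h)
    with K have "h \<in> carrier G" "f h = g h" by auto
    then show ?case by simp
  next
    case (eng h1 h2)
    with f.G.generate_in_carrier[OF K(1)] show ?case by simp
  qed (simp_all add: K)
qed

lemma level_perm_hom:
  assumes cop: "coprime CARD('s::nontriv) t"
  shows "group_hom (affine_sym CARD('s)) (BijGroup UNIV)
     (restrict (level_perm TYPE('s) t) (carrier (affine_sym CARD('s))))"
proof (intro group_hom.intro group_hom_axioms.intro group_BijGroup homI)
  show "group (affine_sym CARD('s))" by (rule group_affine_sym) simp
  fix v w assume v: "v \<in> carrier (affine_sym CARD('s))" and w: "w \<in> carrier (affine_sym CARD('s))"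
  show "restrict (level_perm TYPE('s) t) (carrier (affine_sym CARD('s))) v \<in> carrier (BijGroup UNIV)"
    using v by (simp add: BijGroup_def Bij_def bij_level_perm[OF cop])
  have "v \<circ> w \<in> carrier (affine_sym CARD('s))" by (rule affine_sym_comp[OF _ v w]) simp
  moreover have "level_perm TYPE('s) t (v \<circ> w) = compose UNIV (level_perm TYPE('s) t v) (level_perm TYPE('s) t w)"
    by (simp add: level_perm_comp[OF cop v w] compose_def fun_eq_iff)
  ultimately show "restrict (level_perm TYPE('s) t) (carrier (affine_sym CARD('s))) (v \<otimes>\<^bsub>affine_sym CARD('s)\<^esub> w) =
      restrict (level_perm TYPE('s) t) (carrier (affine_sym CARD('s))) v \<otimes>\<^bsub>BijGroup UNIV\<^esub>
      restrict (level_perm TYPE('s) t) (carrier (affine_sym CARD('s))) w"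
    using v w by (simp add: affine_sym_mult BijGroup_def Bij_def bij_level_perm[OF cop])
qed

text \<open>
  The explicit formula is an action with the prescribed values on the generators; as the generators
  generate, it is the only one.
\<close>

lemma level_action_eq:
  assumes cop: "coprime CARD('s::nontriv) t" and w: "w \<in> carrier (affine_sym CARD('s))"
  shows "level_action TYPE('s) t w = level_perm TYPE('s) t w"
proof -
  let ?C = "carrier (affine_sym CARD('s))"
  let ?p = "restrict (level_perm TYPE('s) t) ?C"
  have "level_action TYPE('s) t = ?p"
    unfolding level_action_def
  proof (rule the_equality)
    show "?p \<in> extensional ?C \<and> group_action (affine_sym CARD('s)) UNIV ?p \<and>
       (\<forall>i::'s mod_ring. ?p (affine_gen i) = level_gen t i)"
      by (auto simp: group_action_def level_perm_hom[OF cop] affine_gen_in_affine_sym level_perm_gen[OF cop])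
  next
    fix \<phi>
    assume \<phi>: "\<phi> \<in> extensional ?C \<and> group_action (affine_sym CARD('s)) UNIV \<phi> \<and>
       (\<forall>i::'s mod_ring. \<phi> (affine_gen i) = level_gen t i)"
    have "\<phi> x = ?p x" if "x \<in> ?C" for x
    proof (rule group_hom_eq_on_generate[of "affine_sym CARD('s)" "BijGroup UNIV" \<phi> ?p "range (affine_gen :: 's mod_ring \<Rightarrow> _)"])
      show "group_hom (affine_sym CARD('s)) (BijGroup UNIV) \<phi>"
        using \<phi> by (simp add: group_action_def)
    qed (use \<phi> that level_perm_hom[OF cop] in \<open>auto simp: affine_sym_generated affine_gen_in_affine_sym level_perm_gen[OF cop]\<close>)
    with \<phi> show "\<phi> = ?p" by (intro extensionalityI[of _ ?C]) auto
  qed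
  with w show ?thesis by simp
qed

section \<open>The geometric action\<close>

text \<open>
  Along the coordinate \<open>k\<close> a point becomes a sequence with \<open>X (k + s) = X k - s t\<close>. The correction by
  \<open>- t k\<close> turns the equation of a wall into \<open>X (k + 1) = X k\<close>, and the affine Weyl group action into
  the permutation of indices \<open>X \<mapsto> X \<circ> w\<inverse>\<close>.
\<close>

definition unrolled :: "nat \<Rightarrow> real ^ ('s::nontriv mod_ring) \<Rightarrow> int \<Rightarrow> real" where
  "unrolled t x k = x $ level_class t k - real t * of_int k"

definition geometric_action ::
    "nat \<Rightarrow> (int \<Rightarrow> int) \<Rightarrow> real ^ ('s::nontriv mod_ring) \<Rightarrow> real ^ ('s mod_ring)" where
  "geometric_action t w = (\<lambda>x\<in>sum_space. \<chi> j.
     let k = level_index t j in unrolled t x (inv_into UNIV w k) + real t * of_int k)"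

lemma unrolled_shift:
  assumes "coprime CARD('s::nontriv) t"
  shows "unrolled t (x :: real ^ 's mod_ring) (k + int CARD('s)) = unrolled t x k + of_int (- int t) * of_nat CARD('s)"
  using level_class_eq_iff[OF assms, of "k + int CARD('s)" k]
  by (simp add: unrolled_def algebra_simps)

lemma unrolled_eqI:
  assumes "coprime CARD('s::nontriv) t" and "unrolled t (x :: real ^ 's mod_ring) = unrolled t y"
  shows "x = y"
proof -
  have "x $ level_class t k = y $ level_class t k" for k
    using fun_cong[OF assms(2), of k] by (simp add: unrolled_def)
  then show ?thesis using surj_level_class[OF assms(1)] by (metis vec_eq_iff)
qed

lemma unrolled_geometric_action:
  assumes cop: "coprime CARD('s::nontriv) t" and w: "w \<in> carrier (affine_sym CARD('s))"
    and x: "x \<in> (sum_space :: (real ^ 's mod_ring) set)"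
  shows "unrolled t (geometric_action t w x) = unrolled t x \<circ> inv_into UNIV w"
proof
  fix k
  let ?i = "level_index t (level_class t k :: 's mod_ring)"
  let ?v = "inv_into UNIV w"
  let ?f = "\<lambda>k. unrolled t x (?v k)"
  have v: "?v \<in> carrier (affine_sym CARD('s))" by (rule affine_sym_inv[OF _ w]) simp
  have "?i mod int CARD('s) = k mod int CARD('s)"
    using level_class_index[OF cop, of "level_class t k"] by (simp add: level_class_eq_iff[OF cop])
  then have "?f ?i - of_int (- int t) * of_int ?i = ?f k - of_int (- int t) * of_int k"
    using v by (intro shift_cong[of _ "CARD('s)"]) (simp_all add: affine_sym_iff unrolled_shift[OF cop])
  then show "unrolled t (geometric_action t w x) k = (unrolled t x \<circ> ?v) k"
    using x by (simp add: geometric_action_def unrolled_def[of t "vec_lambda _"] Let_def)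
qed

lemma sum_space_unrolled:
  assumes cop: "coprime CARD('s::nontriv) t"
  shows "(x :: real ^ 's mod_ring) \<in> sum_space \<longleftrightarrow>
    (\<Sum>k\<in>{0..<int CARD('s)}. unrolled t x k + real t * of_int k) = real (CARD('s) choose 2)"
  using sum_level_class[OF cop, of "\<lambda>j. x $ j"] by (simp add: sum_space_def unrolled_def)

lemma geometric_action_closed:
  assumes cop: "coprime CARD('s::nontriv) t" and w: "w \<in> carrier (affine_sym CARD('s))"
    and x: "x \<in> (sum_space :: (real ^ 's mod_ring) set)"
  shows "geometric_action t w x \<in> sum_space"
proof -
  let ?v = "inv_into UNIV w"
  let ?f = "\<lambda>k. unrolled t x k + real t * of_int k"
  have v: "?v \<in> carrier (affine_sym CARD('s))" by (rule affine_sym_inv[OF _ w]) simp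
  have "(\<Sum>k\<in>{0..<int CARD('s)}. ?f (?v k)) = (\<Sum>k\<in>{0..<int CARD('s)}. ?f k)"
    using v by (intro sum_period_reindex[of _ ?f]) (auto simp: affine_sym_iff unrolled_shift[OF cop] algebra_simps)
  moreover have "(\<Sum>k\<in>{0..<int CARD('s)}. real t * of_int (?v k - k)) = 0"
    using v by (simp only: sum_distrib_left[symmetric] of_int_sum[symmetric]) (simp add: affine_sym_iff)
  moreover have "(\<Sum>k\<in>{0..<int CARD('s)}. unrolled t (geometric_action t w x) k + real t * of_int k) =
     (\<Sum>k\<in>{0..<int CARD('s)}. ?f (?v k) - real t * of_int (?v k - k))"
    by (simp add: unrolled_geometric_action[OF cop w x] algebra_simps)
  ultimately show ?thesis using x by (simp add: sum_space_unrolled[OF cop] sum_subtractf)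
qed

lemma geometric_action_comp:
  assumes cop: "coprime CARD('s::nontriv) t"
    and v: "v \<in> carrier (affine_sym CARD('s))" and w: "w \<in> carrier (affine_sym CARD('s))"
    and x: "x \<in> (sum_space :: (real ^ 's mod_ring) set)"
  shows "geometric_action t (v \<circ> w) x = geometric_action t v (geometric_action t w x)"
proof (rule unrolled_eqI[OF cop])
  have vw: "v \<circ> w \<in> carrier (affine_sym CARD('s))" by (rule affine_sym_comp[OF _ v w]) simp
  have "inv_into UNIV (v \<circ> w) = inv_into UNIV w \<circ> inv_into UNIV v"
    using v w by (simp add: affine_sym_iff o_inv_distrib)
  then show "unrolled t (geometric_action t (v \<circ> w) x) = unrolled t (geometric_action t v (geometric_action t w x))"
    unfolding unrolled_geometric_action[OF cop vw x] unrolled_geometric_action[OF cop w x]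
      unrolled_geometric_action[OF cop v geometric_action_closed[OF cop w x]]
    by (simp add: comp_assoc)
qed

lemma geometric_action_id:
  assumes cop: "coprime CARD('s::nontriv) t" and x: "x \<in> (sum_space :: (real ^ 's mod_ring) set)"
  shows "geometric_action t id x = x"
  by (rule unrolled_eqI[OF cop]) (simp add: unrolled_geometric_action[OF cop id_affine_sym x])

lemma geometric_action_Bij:
  assumes cop: "coprime CARD('s::nontriv) t" and w: "w \<in> carrier (affine_sym CARD('s))"
  shows "geometric_action t w \<in> Bij (sum_space :: (real ^ 's mod_ring) set)"
proof -
  let ?v = "inv_into UNIV w"
  have v: "?v \<in> carrier (affine_sym CARD('s))" by (rule affine_sym_inv[OF _ w]) simp
  have eq: "?v \<circ> w = id" "w \<circ> ?v = id"
    using w by (auto simp: affine_sym_iff bij_def surj_iff)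
  have "bij_betw (geometric_action t w) sum_space (sum_space :: (real ^ 's mod_ring) set)"
  proof (rule bij_betwI[of _ _ _ "geometric_action t ?v"])
    fix x :: "real ^ 's mod_ring" assume x: "x \<in> sum_space"
    show "geometric_action t ?v (geometric_action t w x) = x"
      using geometric_action_comp[OF cop v w x] by (simp add: eq geometric_action_id[OF cop x])
    show "geometric_action t w (geometric_action t ?v x) = x"
      using geometric_action_comp[OF cop w v x] by (simp add: eq geometric_action_id[OF cop x])
  qed (auto simp: geometric_action_closed[OF cop] v w)
  then show ?thesis by (simp add: Bij_def geometric_action_def)
qed

lemma geometric_action_hom:
  assumes cop: "coprime CARD('s::nontriv) t"
  shows "group_hom (affine_sym CARD('s)) (BijGroup (sum_space :: (real ^ 's mod_ring) set)) (geometric_action t)"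
proof (intro group_hom.intro group_hom_axioms.intro group_BijGroup homI)
  show "group (affine_sym CARD('s))" by (rule group_affine_sym) simp
  fix v w assume v: "v \<in> carrier (affine_sym CARD('s))" and w: "w \<in> carrier (affine_sym CARD('s))"
  show "geometric_action t v \<in> carrier (BijGroup (sum_space :: (real ^ 's mod_ring) set))"
    by (simp add: BijGroup_def geometric_action_Bij[OF cop v])
  have "geometric_action t (v \<circ> w) =
      compose (sum_space :: (real ^ 's mod_ring) set) (geometric_action t v) (geometric_action t w)"
    by (rule extensionalityI[of _ sum_space])
       (auto simp: geometric_action_def[of t "v \<circ> w"] compose_eq geometric_action_comp[OF cop v w, symmetric])
  then show "geometric_action t (v \<otimes>\<^bsub>affine_sym CARD('s)\<^esub> w) =
      geometric_action t v \<otimes>\<^bsub>BijGroup (sum_space :: (real ^ 's mod_ring) set)\<^esub> geometric_action t w"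
    using v w by (simp add: affine_sym_mult BijGroup_def geometric_action_Bij[OF cop])
qed

text \<open>
  The point of \<open>sum_space\<close> with all coordinates equal unrolls to an injective sequence because
  \<open>t > 0\<close>, so its image under \<open>w\<close> determines \<open>w\<close>.
\<close>

lemma geometric_action_inj:
  assumes cop: "coprime CARD('s::nontriv) t" and t: "0 < t"
  shows "inj_on (geometric_action t :: _ \<Rightarrow> real ^ 's mod_ring \<Rightarrow> _) (carrier (affine_sym CARD('s)))"
proof (rule inj_onI)
  fix v w
  assume v: "v \<in> carrier (affine_sym CARD('s))" and w: "w \<in> carrier (affine_sym CARD('s))"
    and eq: "(geometric_action t v :: real ^ 's mod_ring \<Rightarrow> _) = geometric_action t w"
  define x :: "real ^ 's mod_ring" where "x = (\<chi> j. (real CARD('s) - 1) / 2)"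
  have "2 * (CARD('s) choose 2) = CARD('s) * (CARD('s) - 1)" by (simp add: choose_two)
  then have "2 * real (CARD('s) choose 2) = real CARD('s) * real (CARD('s) - 1)"
    by (metis of_nat_mult of_nat_numeral)
  then have "real (CARD('s) choose 2) = real CARD('s) * (real CARD('s) - 1) / 2" by (simp add: of_nat_diff)
  then have x: "x \<in> sum_space" by (simp add: sum_space_def x_def)
  have "unrolled t x \<circ> inv_into UNIV v = unrolled t x \<circ> inv_into UNIV w"
    using eq unrolled_geometric_action[OF cop v x] unrolled_geometric_action[OF cop w x] by simp
  moreover have "inj (unrolled t x)" using t by (auto simp: inj_def unrolled_def x_def)
  ultimately have "inv_into UNIV v = inv_into UNIV w"
    by (simp add: fun_eq_iff inj_eq)
  then show "v = w" using v w by (metis affine_sym_iff inv_inv_eq)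
qed

section \<open>Generators act as reflections\<close>

lemma of_nat_level_nonzero:
  assumes "coprime CARD('s::nontriv) t"
  shows "(of_nat t :: 's mod_ring) \<noteq> 0"
proof
  assume "(of_nat t :: 's mod_ring) = 0"
  then have "(of_int (int t) :: 's mod_ring) = of_int 0" by simp
  then have "CARD('s) dvd t" unfolding of_int_mod_ring_eq_iff by (simp add: mod_eq_0_iff_dvd)
  then show False using assms card_nontriv[where 's='s] by (auto dest: coprime_common_divisor_nat)
qed

text \<open>
  The vector \<open>e\<^sub>j - e\<^sub>j\<^sub>-\<^sub>t\<close> is normal to the wall and tangent to the ambient
  hyperplane \<open>sum_space\<close>, and its squared length is \<open>2\<close>. Subtracting the proper multiple of it leads into
  the wall, and by Pythagoras no other point of the wall is closer.
\<close>

lemma closest_point_wall: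
  fixes x :: "real ^ 's::nontriv mod_ring"
  assumes cop: "coprime CARD('s) t" and x: "x \<in> sum_space"
  shows "closest_point (wall t j) x =
    x - ((x $ j - x $ (j - of_nat t) - real t) / 2) *\<^sub>R (axis j 1 - axis (j - of_nat t) 1)"
    (is "_ = x - ?d *\<^sub>R ?u")
proof -
  have ne: "j - of_nat t \<noteq> j" using of_nat_level_nonzero[OF cop] by simp
  let ?p = "x - ?d *\<^sub>R ?u"
  let ?H = "{x :: real ^ 's mod_ring. (\<chi> i. 1) \<bullet> x = real (CARD('s) choose 2)} \<inter> {x. ?u \<bullet> x = real t}"
  have inner_u: "?u \<bullet> y = y $ j - y $ (j - of_nat t)" for y :: "real ^ 's mod_ring"
    by (simp add: inner_diff_left inner_axis')
  have inner_one: "(\<chi> i. 1) \<bullet> y = (\<Sum>i\<in>UNIV. y $ i)" for y :: "real ^ 's mod_ring"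
    by (simp add: inner_vec_def)
  have wall: "wall t j = ?H"
    unfolding wall_def sum_space_def inner_u inner_one by auto
  have uu: "?u \<bullet> ?u = 2" unfolding inner_u using ne ne[symmetric] by (simp add: axis_def)
  have ou: "(\<chi> i. 1) \<bullet> ?u = 0" unfolding inner_one by (simp add: sum_subtractf axis_def)
  have ux: "?u \<bullet> x = 2 * ?d + real t" unfolding inner_u by (simp add: field_simps)
  have p: "?p \<in> wall t j"
  proof -
    have "(\<chi> i. 1) \<bullet> x = real (CARD('s) choose 2)" using x by (simp add: sum_space_def inner_one)
    moreover have "(\<chi> i. 1) \<bullet> ?p = (\<chi> i. 1) \<bullet> x" unfolding inner_diff_right[of _ x] inner_scaleR_right ou by simp
    moreover have "?u \<bullet> ?p = real t" unfolding inner_diff_right[of _ x] inner_scaleR_right uu ux by simp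
    ultimately show ?thesis unfolding wall by simp
  qed
  have "?p = closest_point (wall t j) x"
  proof (rule closest_point_unique[OF _ _ p])
    show "convex (wall t j)" unfolding wall by (intro convex_Int convex_hyperplane)
    show "closed (wall t j)" unfolding wall by (intro closed_Int closed_hyperplane)
    show "\<forall>z\<in>wall t j. dist x ?p \<le> dist x z"
    proof
      fix z assume "z \<in> wall t j"
      with p have "?u \<bullet> (?p - z) = 0" unfolding wall by (simp add: inner_diff_right)
      then have "orthogonal (x - ?p) (?p - z)" by (simp add: orthogonal_def)
      then have "(norm (x - z))\<^sup>2 = (norm (x - ?p))\<^sup>2 + (norm (?p - z))\<^sup>2"
        using norm_add_Pythagorean[of "x - ?p" "?p - z"] by simp
      then have "(norm (x - ?p))\<^sup>2 \<le> (norm (x - z))\<^sup>2" by simp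
      then show "dist x ?p \<le> dist x z" unfolding dist_norm by (rule power2_le_imp_le) simp
    qed
  qed
  then show ?thesis by simp
qed

lemma wall_unrolled:
  "(x :: real ^ 's::nontriv mod_ring) \<in> wall t (level_class t (k + 1)) \<longleftrightarrow>
     x \<in> sum_space \<and> unrolled t x (k + 1) = unrolled t x k"
  unfolding wall_def unrolled_def level_class_shift by (auto simp: algebra_simps)

text \<open>
  Both maps replace the coordinates \<open>(x\<^sub>j, x\<^sub>i)\<close> at \<open>j\<close> and \<open>i = j - t\<close> by
  \<open>(x\<^sub>i + t, x\<^sub>j - t)\<close> and leave all others alone.
\<close>

lemma geometric_action_gen:
  assumes cop: "coprime CARD('s::nontriv) t"
  shows "geometric_action t (affine_gen (of_int (k + 1) :: 's mod_ring)) =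
    wall_reflection t (level_class t (k + 1) :: 's mod_ring)"
proof (rule extensionalityI[of _ sum_space])
  let ?g = "affine_gen (of_int (k + 1) :: 's mod_ring)" and ?j = "level_class t (k + 1) :: 's mod_ring"
  fix x :: "real ^ 's mod_ring" assume x: "x \<in> sum_space"
  have ne: "level_class t k \<noteq> (level_class t k + of_nat t :: 's mod_ring)" using of_nat_level_nonzero[OF cop] by simp
  have ginv: "inv_into UNIV ?g = ?g" by (rule inv_unique_comp) (auto simp: affine_gen_involution)
  have r: "wall_reflection t ?j x = x - (x $ ?j - x $ (?j - of_nat t) - real t) *\<^sub>R (axis ?j 1 - axis (?j - of_nat t) 1)"
  proof -
    have "2 *\<^sub>R (x - (d / 2) *\<^sub>R u) - x = x - d *\<^sub>R u" for d and u :: "real ^ 's mod_ring"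
      by (simp add: scaleR_right_diff_distrib scaleR_2)
    with x show ?thesis by (simp add: wall_reflection_def closest_point_wall[OF cop x])
  qed
  have val: "wall_reflection t ?j x $ i =
     (if i = level_class t k then x $ level_class t (k + 1) - real t
      else if i = level_class t (k + 1) then x $ level_class t k + real t else x $ i)" for i
    using ne unfolding r unfolding level_class_shift by (auto simp: axis_def)
  show "geometric_action t ?g x = wall_reflection t ?j x"
  proof (rule unrolled_eqI[OF cop], rule ext)
    fix m
    have 1: "of_int m = (of_int (k + 1) - 1 :: 's mod_ring) \<longleftrightarrow> (level_class t m :: 's mod_ring) = level_class t k"
      by (simp add: level_class_eq_iff[OF cop] of_int_mod_ring_eq_iff)
    have 2: "of_int m = (of_int (k + 1) :: 's mod_ring) \<longleftrightarrow> (level_class t m :: 's mod_ring) = level_class t (k + 1)"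
      unfolding level_class_eq_iff[OF cop] of_int_mod_ring_eq_iff ..
    have 3: "level_class t (m - 1) = (level_class t m - of_nat t :: 's mod_ring)"
      by (simp add: level_class_def algebra_simps)
    show "unrolled t (geometric_action t ?g x) m = unrolled t (wall_reflection t ?j x) m"
      unfolding unrolled_geometric_action[OF cop affine_gen_in_affine_sym x] ginv comp_apply
        unrolled_def val affine_gen_apply 1 2
      using ne by (auto simp: 3 level_class_shift distrib_left right_diff_distrib)
  qed
qed (auto simp: geometric_action_def wall_reflection_def)

section \<open>Beta-sets of partitions\<close>

lemma partition_antimono:
  assumes "is_partition lam" "1 \<le> i" "i \<le> j"
  shows "lam j \<le> lam i"
  using assms(3)
proof (induction j rule: dec_induct)
  case (step n)
  then have "lam (Suc n) \<le> lam n" using assms(1,2) by (simp add: is_partition_def)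
  with step show ?case by simp
qed simp

lemma beta_strict_antimono:
  assumes "is_partition lam" "1 \<le> i" "i < j"
  shows "int (lam j) - int j < int (lam i) - int i"
  using partition_antimono[OF assms(1,2), of j] assms(3) by simp

lemma beta_less_iff:
  assumes "is_partition lam" "1 \<le> i" "1 \<le> j"
  shows "int (lam j) - int j < int (lam i) - int i \<longleftrightarrow> i < j"
proof
  assume l: "int (lam j) - int j < int (lam i) - int i"
  show "i < j"
  proof (rule ccontr)
    assume "\<not> i < j"
    then consider "j < i" | "i = j" by linarith
    then show False using l beta_strict_antimono[OF assms(1,3), of i] by cases auto
  qed
qed (rule beta_strict_antimono[OF assms(1,2)])

lemma beta_inj_on:
  assumes "is_partition lam" "A \<subseteq> {1..}"
  shows "inj_on (\<lambda>j. int (lam j) - int j) A"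
proof (rule inj_onI)
  fix i j assume "i \<in> A" "j \<in> A" and eq: "int (lam i) - int i = int (lam j) - int j"
  then have "1 \<le> i" "1 \<le> j" using assms(2) by auto
  with eq beta_less_iff[OF assms(1), of i j] beta_less_iff[OF assms(1), of j i] show "i = j" by simp
qed

text \<open>
  The beta-set is enumerated in strictly decreasing order, so the index of a beta-number is
  determined by the number of larger ones. This recovers the partition from its beta-set.
\<close>

lemma beta_rank:
  assumes "is_partition lam" "1 \<le> i"
  shows "card {b \<in> beta_set lam. int (lam i) - int i < b} = i - 1"
proof -
  have "{b \<in> beta_set lam. int (lam i) - int i < b} = (\<lambda>j. int (lam j) - int j) ` {1..<i}"
    using beta_less_iff[OF assms(1) _ assms(2)] by (auto simp: beta_set_def)
  moreover have "inj_on (\<lambda>j. int (lam j) - int j) {1..<i}"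
    by (rule beta_inj_on[OF assms(1)]) auto
  ultimately show ?thesis by (simp add: card_image)
qed

lemma beta_set_injective:
  assumes "is_partition lam" "is_partition mu" and eq: "beta_set lam = beta_set mu"
  shows "lam = mu"
proof
  fix i show "lam i = mu i"
  proof (cases "1 \<le> i")
    case True
    then have "int (lam i) - int i \<in> beta_set mu" unfolding eq[symmetric] by (auto simp: beta_set_def)
    then obtain j where j: "1 \<le> j" "int (lam i) - int i = int (mu j) - int j" by (auto simp: beta_set_def)
    have "i - 1 = j - 1"
      using beta_rank[OF assms(1) True] beta_rank[OF assms(2) j(1)] by (simp add: eq j(2))
    with j(1) True have "i = j" by linarith
    with j(2) show ?thesis by simp
  next
    case False
    then have "i = 0" by simp
    with assms(1,2) show ?thesis by (simp add: is_partition_def)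
  qed
qed

text \<open>
  Beta-sets of partitions are the sets of integers of charge zero: those which differ from the
  negative integers by as many insertions as deletions, finite in number. Counting above a threshold
  \<open>- N\<close> below which nothing is missing expresses this.
\<close>

definition balanced_above :: "int set \<Rightarrow> nat \<Rightarrow> bool" where
  "balanced_above B N \<longleftrightarrow> (\<forall>m < - int N. m \<in> B) \<and>
     finite {m \<in> B. - int N \<le> m} \<and> card {m \<in> B. - int N \<le> m} = N"

lemma beta_set_balanced:
  assumes "is_partition lam"
  shows "\<exists>N0. \<forall>N\<ge>N0. balanced_above (beta_set lam) N"
proof -
  obtain N0 where N0: "\<forall>i\<ge>N0. lam i = 0" using assms by (auto simp: is_partition_def)
  have "balanced_above (beta_set lam) N" if N: "N0 \<le> N" for N
  proof -
    have "m \<in> beta_set lam" if "m < - int N" for m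
    proof -
      have "N0 \<le> nat (- m)" "1 \<le> nat (- m)" using that N by linarith+
      with N0 have "m = int (lam (nat (- m))) - int (nat (- m))" by simp
      with \<open>1 \<le> nat (- m)\<close> show ?thesis unfolding beta_set_def by blast
    qed
    moreover have "{m \<in> beta_set lam. - int N \<le> m} = (\<lambda>j. int (lam j) - int j) ` {1..N}"
    proof -
      have iff: "- int N \<le> int (lam j) - int j \<longleftrightarrow> j \<le> N" for j
      proof (cases "j \<le> N")
        case False
        with N N0 have "lam j = 0" by simp
        with False show ?thesis by simp
      qed simp
      have "{m \<in> beta_set lam. - int N \<le> m} =
          (\<lambda>j. int (lam j) - int j) ` {j. 1 \<le> j \<and> - int N \<le> int (lam j) - int j}"
        unfolding beta_set_def by blast
      then show ?thesis unfolding iff by (simp add: atLeastAtMost_def atLeast_def atMost_def Collect_conj_eq)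
    qed
    moreover have "inj_on (\<lambda>j. int (lam j) - int j) {1..N}"
      by (rule beta_inj_on[OF assms]) auto
    ultimately show ?thesis by (simp add: balanced_above_def card_image)
  qed
  then show ?thesis by blast
qed

text \<open>
  The parts are read off from the decreasing list \<open>xs\<close> of the \<open>N\<close> elements that are at least \<open>- N\<close>.
\<close>

lemma balanced_is_beta_set:
  assumes "balanced_above B N"
  shows "\<exists>lam. is_partition lam \<and> beta_set lam = B"
proof -
  let ?F = "{m \<in> B. - int N \<le> m}"
  have B: "\<And>m. m < - int N \<Longrightarrow> m \<in> B" and fin: "finite ?F" and card: "card ?F = N"
    using assms by (auto simp: balanced_above_def)
  define xs where "xs = rev (sorted_list_of_set ?F)"
  have len: "length xs = N" by (simp add: xs_def card)
  have set: "set xs = ?F" by (simp add: xs_def fin)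
  have dec: "xs ! j < xs ! i" if "i < j" "j < N" for i j
  proof -
    have "sorted_wrt (\<lambda>x y. y < x) xs" unfolding xs_def sorted_wrt_rev by simp
    with that len show ?thesis by (simp add: sorted_wrt_iff_nth_less)
  qed
  \<comment> \<open>The last entry is at least \<open>- N\<close> and the list is strictly decreasing; hence the parts are
     non-negative. List positions start at 0, parts at 1.\<close>
  have low: "- int i - 1 \<le> xs ! i" if "i < N" for i
    using that
  proof (induction "N - 1 - i" arbitrary: i)
    case 0
    then have "i = N - 1" by simp
    moreover have "xs ! i \<in> ?F" using 0 set len nth_mem by metis
    ultimately show ?case using 0 by auto
  next
    case (Suc d)
    then have "- int (Suc i) - 1 \<le> xs ! Suc i" by (intro Suc.hyps) auto
    moreover have "xs ! Suc i < xs ! i" using Suc by (intro dec) auto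
    ultimately show ?case by simp
  qed
  define lam where "lam i = (if 1 \<le> i \<and> i \<le> N then nat (xs ! (i - 1) + int i) else 0)" for i
  have val: "int (lam i) - int i = xs ! (i - 1)" if "1 \<le> i" "i \<le> N" for i
  proof -
    have "i - 1 < N" using that by linarith
    from low[OF this] that show ?thesis by (simp add: lam_def of_nat_diff)
  qed
  have "is_partition lam"
    unfolding is_partition_def
  proof (intro conjI allI impI)
    fix i :: nat assume "1 \<le> i"
    show "lam (Suc i) \<le> lam i"
    proof (cases "Suc i \<le> N")
      case True
      then have "xs ! i < xs ! (i - 1)" using \<open>1 \<le> i\<close> by (intro dec) auto
      then show ?thesis using True \<open>1 \<le> i\<close> by (simp add: lam_def)
    qed (simp add: lam_def)
  next
    show "\<exists>N. \<forall>i\<ge>N. lam i = 0" by (rule exI[of _ "Suc N"]) (simp add: lam_def)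
  qed (simp add: lam_def)
  moreover have "beta_set lam = B"
  proof (intro equalityI subsetI)
    fix m assume "m \<in> beta_set lam"
    then obtain i where i: "1 \<le> i" "m = int (lam i) - int i" by (auto simp: beta_set_def)
    show "m \<in> B"
    proof (cases "i \<le> N")
      case True
      then have "m = xs ! (i - 1)" using i val by simp
      moreover have "xs ! (i - 1) \<in> set xs" using True i len by (intro nth_mem) simp
      ultimately show ?thesis by (simp add: set)
    next
      case False
      then show ?thesis using i by (intro B) (simp add: lam_def)
    qed
  next
    fix m assume m: "m \<in> B"
    show "m \<in> beta_set lam"
    proof (cases "- int N \<le> m")
      case True
      with m have "m \<in> set xs" by (simp add: set)
      then obtain i where "i < N" "xs ! i = m" by (metis in_set_conv_nth len)
      then show ?thesis using val[of "Suc i"] by (auto simp: beta_set_def intro!: exI[of _ "Suc i"])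
    next
      case False
      then show ?thesis by (auto simp: beta_set_def lam_def intro!: exI[of _ "nat (- m)"])
    qed
  qed
  ultimately show ?thesis by blast
qed

text \<open>
  If \<open>x = \<lambda>\<^sub>i - i\<close> is a beta-number and \<open>y = x - r\<close> is not, then \<open>r\<close> is a hook length in row \<open>i\<close>:
  with \<open>q\<close> the number of beta-numbers above \<open>y\<close>, the column \<open>c = y + q + 1\<close> has length \<open>q\<close>, so the
  hook at \<open>(i, c)\<close> has length \<open>x - (c - 1 - q) = r\<close>.
\<close>

lemma core_beta_shift:
  assumes core: "lam \<in> cores r" and r: "0 < r" and x: "x \<in> beta_set lam"
  shows "x - int r \<in> beta_set lam"
proof (rule ccontr)
  assume y: "x - int r \<notin> beta_set lam"
  let ?y = "x - int r"
  have p: "is_partition lam" using core by (simp add: cores_def)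
  obtain i where i: "1 \<le> i" "x = int (lam i) - int i" using x by (auto simp: beta_set_def)
  define Q where "Q = {j. 1 \<le> j \<and> ?y < int (lam j) - int j}"
  have down: "j \<in> Q" if "j' \<in> Q" "1 \<le> j" "j \<le> j'" for j j'
    using that beta_strict_antimono[OF p, of j j'] by (cases "j = j'") (auto simp: Q_def)
  obtain N where N: "\<forall>j\<ge>N. lam j = 0" using p by (auto simp: is_partition_def)
  have "Q \<subseteq> {..max N (nat (- ?y))}"
  proof
    fix j assume "j \<in> Q"
    then show "j \<in> {..max N (nat (- ?y))}" using N by (cases "N \<le> j") (auto simp: Q_def)
  qed
  then have fin: "finite Q" by (rule finite_subset) simp
  have iQ: "i \<in> Q" using i r by (simp add: Q_def)
  define q where "q = Max Q"
  have q: "q \<in> Q" "i \<le> q" using fin iQ by (auto simp: q_def intro: Max_in)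
  have Q: "Q = {1..q}"
    using down[OF q(1)] fin by (auto simp: q_def Q_def)
  have "Suc q \<notin> Q" by (simp add: Q)
  moreover have "int (lam (Suc q)) - int (Suc q) \<in> beta_set lam"
    unfolding beta_set_def by (intro CollectI exI[of _ "Suc q"]) simp
  ultimately have next_le: "int (lam (Suc q)) - int (Suc q) < ?y"
    using y by (auto simp: Q_def intro: le_neq_trans)
  \<comment> \<open>The inequality \<open>next_le\<close> makes the column index positive.\<close>
  define c where "c = nat (?y + int q + 1)"
  have c: "int c = ?y + int q + 1" using next_le by (simp add: c_def)
  have c1: "1 \<le> c" using c next_le by linarith
  have "{j. 1 \<le> j \<and> c \<le> lam j} = {1..q}"
  proof (intro equalityI subsetI)
    fix j assume j: "j \<in> {j. 1 \<le> j \<and> c \<le> lam j}"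
    have "j \<le> q"
    proof (rule ccontr)
      assume "\<not> j \<le> q"
      then have "lam j \<le> lam (Suc q)" by (intro partition_antimono[OF p]) auto
      with j next_le c show False by simp
    qed
    with j show "j \<in> {1..q}" by simp
  next
    fix j assume j: "j \<in> {1..q}"
    then have "lam q \<le> lam j" by (intro partition_antimono[OF p]) auto
    moreover have "c \<le> lam q" using q(1) c by (simp add: Q_def)
    ultimately show "j \<in> {j. 1 \<le> j \<and> c \<le> lam j}" using j by simp
  qed
  then have conj: "conjugate lam c = q" by (simp add: conjugate_def)
  have "lam q \<le> lam i" using i q by (intro partition_antimono[OF p]) auto
  then have "c \<le> lam i" using q(1) c by (simp add: Q_def)
  moreover have "hook_length lam i c = int r" using c i by (simp add: hook_length_def conj)
  ultimately show False using core i c1 by (auto simp: cores_def)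
qed

section \<open>Abaci\<close>

text \<open>
  A set of integers closed under subtraction of \<open>s\<close> is given by one threshold for every residue class:
  beads fill each runner of an abacus up to the first gap. The thresholds of the beta-set of a core
  form its \<open>s\<close>-set.
\<close>

definition transversal :: "('s::nontriv mod_ring \<Rightarrow> int) \<Rightarrow> bool" where
  "transversal a \<longleftrightarrow> (\<forall>i. of_int (a i) = i)"

definition abacus :: "('s::nontriv mod_ring \<Rightarrow> int) \<Rightarrow> int set" where
  "abacus a = {m. m < a (of_int m)}"

lemma abacus_injective:
  assumes "transversal a" "transversal b" "abacus a = abacus b"
  shows "a = b"
proof
  fix i
  have "a i \<notin> abacus a" "b i \<notin> abacus b" using assms(1,2) by (auto simp: abacus_def transversal_def)
  then have "a i \<notin> abacus b" "b i \<notin> abacus a" by (simp_all add: assms(3))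
  then have "b i \<le> a i" "a i \<le> b i" using assms(1,2) by (simp_all add: abacus_def transversal_def)
  then show "a i = b i" by simp
qed

text \<open>
  Write the first gap on the runner of \<open>r \<in> {0..<s}\<close> as \<open>r + q\<^sub>r s\<close>. From \<open>- M s\<close> on this runner carries
  \<open>q\<^sub>r + M\<close> beads, and the sum of the first gaps is \<open>0 + \<dots> + (s - 1)\<close> plus \<open>s\<close> times the sum of the
  \<open>q\<^sub>r\<close>.
\<close>

lemma abacus_count:
  fixes a :: "'s::nontriv mod_ring \<Rightarrow> int"
  assumes a: "transversal a" and M: "\<And>i. - int (M * CARD('s)) \<le> a i"
  shows "finite {m \<in> abacus a. - int (M * CARD('s)) \<le> m}"
    and "int CARD('s) * int (card {m \<in> abacus a. - int (M * CARD('s)) \<le> m}) =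
           (\<Sum>i\<in>UNIV. a i) - int (CARD('s) choose 2) + int CARD('s) * int (M * CARD('s))"
proof -
  let ?s = "int CARD('s)"
  define q where "q r = (a (of_int r) - r) div ?s" for r
  have s: "?s > 0" by simp
  have q: "a (of_int r) = r + q r * ?s" for r
  proof -
    have "(of_int (a (of_int r)) :: 's mod_ring) = of_int r" using a by (simp add: transversal_def)
    then have "?s dvd a (of_int r) - r" by (simp add: of_int_mod_ring_eq_iff mod_eq_dvd_iff)
    then show ?thesis by (simp add: q_def)
  qed
  let ?S = "Sigma {0..<?s} (\<lambda>r. {- int M..<q r})"
  let ?f = "\<lambda>(r, k). r + k * ?s"
  have class_eq: "(of_int (r + k * ?s) :: 's mod_ring) = of_int r" for r k
    unfolding of_int_mod_ring_eq_iff by simp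
  have bound: "- int (M * CARD('s)) \<le> r + k * ?s \<longleftrightarrow> - int M \<le> k" if "r \<in> {0..<?s}" for r k
  proof -
    have "- int (M * CARD('s)) \<le> r + k * ?s \<longleftrightarrow> 0 \<le> r + (k + int M) * ?s"
      unfolding of_nat_mult distrib_right by linarith
    also have "\<dots> \<longleftrightarrow> 0 \<le> (r + (k + int M) * ?s) div ?s" by (simp only: pos_imp_zdiv_nonneg_iff[OF s])
    also have "(r + (k + int M) * ?s) div ?s = k + int M" using that by simp
    finally show ?thesis by auto
  qed
  have img: "{m \<in> abacus a. - int (M * CARD('s)) \<le> m} = ?f ` ?S"
  proof (intro equalityI subsetI)
    fix m assume m: "m \<in> {m \<in> abacus a. - int (M * CARD('s)) \<le> m}"
    define r k where "r = m mod ?s" and "k = m div ?s"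
    have mrk: "m = r + k * ?s" by (simp add: r_def k_def)
    have r: "r \<in> {0..<?s}" by (simp add: r_def)
    have "r + k * ?s < r + q r * ?s"
      using m unfolding abacus_def mrk by (simp add: class_eq[simplified] q[symmetric])
    then have "k < q r" using s by simp
    moreover have "- int M \<le> k" using m bound[OF r] unfolding mrk by simp
    ultimately show "m \<in> ?f ` ?S" using r mrk by (intro image_eqI[of _ _ "(r, k)"]) auto
  next
    fix m assume "m \<in> ?f ` ?S"
    then obtain r k where rk: "m = r + k * ?s" "r \<in> {0..<?s}" "- int M \<le> k" "k < q r" by auto
    have "m < a (of_int m)" unfolding rk(1) class_eq q using rk(4) s by simp
    moreover have "- int (M * CARD('s)) \<le> m" unfolding rk(1) bound[OF rk(2)] by (rule rk(3))
    ultimately show "m \<in> {m \<in> abacus a. - int (M * CARD('s)) \<le> m}" by (simp add: abacus_def)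
  qed
  have inj: "inj_on ?f ?S"
  proof (rule inj_onI, clarify)
    fix r k r' k' assume r: "r \<in> {0..<?s}" "r' \<in> {0..<?s}" and eq: "r + k * ?s = r' + k' * ?s"
    have "r = (r + k * ?s) mod ?s" using r(1) by simp
    also have "\<dots> = r'" unfolding eq using r(2) by simp
    finally have "r = r'" .
    with eq s show "r = r' \<and> k = k'" by simp
  qed
  show "finite {m \<in> abacus a. - int (M * CARD('s)) \<le> m}" unfolding img by simp
  have nonneg: "0 \<le> q r + int M" if "r \<in> {0..<?s}" for r
    using bound[OF that, of "q r"] M[of "of_int r"] by (simp add: q)
  have "int (card {m \<in> abacus a. - int (M * CARD('s)) \<le> m}) = (\<Sum>r\<in>{0..<?s}. int (nat (q r + int M)))"
    unfolding img by (simp add: card_image[OF inj] card_SigmaI)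
  also have "\<dots> = (\<Sum>r\<in>{0..<?s}. q r + int M)" by (rule sum.cong[OF refl]) (use nonneg in auto)
  finally have "?s * int (card {m \<in> abacus a. - int (M * CARD('s)) \<le> m}) = (\<Sum>r\<in>{0..<?s}. q r * ?s + int M * ?s)"
    by (simp only: sum_distrib_left) (simp add: algebra_simps)
  also have "\<dots> = (\<Sum>r\<in>{0..<?s}. (a (of_int r) - r) + int M * ?s)" by (simp add: q)
  also have "\<dots> = (\<Sum>r\<in>{0..<?s}. a (of_int r)) - (\<Sum>r\<in>{0..<?s}. r) + ?s * (int M * ?s)"
    by (simp add: sum.distrib sum_subtractf)
  finally show "?s * int (card {m \<in> abacus a. - int (M * CARD('s)) \<le> m}) =
           (\<Sum>i\<in>UNIV. a i) - int (CARD('s) choose 2) + ?s * int (M * CARD('s))"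
    by (simp add: sum_residues sum_int_interval)
qed

text \<open>
  Charge zero for an abacus is therefore the equation of \<open>sum_space\<close> for its first gaps.
\<close>

lemma abacus_balanced_iff:
  fixes a :: "'s::nontriv mod_ring \<Rightarrow> int"
  assumes a: "transversal a" and M: "\<And>i. - int (M * CARD('s)) \<le> a i"
  shows "balanced_above (abacus a) (M * CARD('s)) \<longleftrightarrow> (\<Sum>i\<in>UNIV. a i) = int (CARD('s) choose 2)"
proof -
  let ?c = "card {m \<in> abacus a. - int (M * CARD('s)) \<le> m}"
  have "\<forall>m < - int (M * CARD('s)). m \<in> abacus a" using M by (auto simp: abacus_def intro: less_le_trans)
  then have "balanced_above (abacus a) (M * CARD('s)) \<longleftrightarrow> ?c = M * CARD('s)"
    using abacus_count(1)[OF assms] by (simp add: balanced_above_def)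
  also have "\<dots> \<longleftrightarrow> int CARD('s) * int ?c = int CARD('s) * int (M * CARD('s))"
    by (simp only: mult_cancel_left of_nat_eq_iff) simp
  finally show ?thesis unfolding abacus_count(2)[OF assms] by simp
qed

lemma lower_bound_multiple:
  fixes a :: "'s::nontriv mod_ring \<Rightarrow> int"
  shows "\<exists>M0. \<forall>M\<ge>M0. \<forall>i. - int (M * CARD('s)) \<le> a i"
proof -
  \<comment> \<open>Any bound for the absolute values of the \<open>a i\<close> will do, as \<open>M \<le> M * CARD('s)\<close>.\<close>
  define M0 where "M0 = nat (\<Sum>i\<in>UNIV. \<bar>a i\<bar>)"
  have "- int (M * CARD('s)) \<le> a i" if "M0 \<le> M" for M i
  proof -
    have "\<bar>a i\<bar> \<le> (\<Sum>i\<in>UNIV. \<bar>a i\<bar>)" by (rule member_le_sum) auto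
    also have "\<dots> \<le> int M" using that by (simp add: M0_def)
    also have "\<dots> \<le> int (M * CARD('s))" by (simp del: of_nat_mult)
    finally show ?thesis by linarith
  qed
  then show ?thesis by blast
qed

lemma abacus_is_beta_set:
  fixes a :: "'s::nontriv mod_ring \<Rightarrow> int"
  assumes a: "transversal a" and "(\<Sum>i\<in>UNIV. a i) = int (CARD('s) choose 2)"
  shows "\<exists>lam. is_partition lam \<and> beta_set lam = abacus a"
proof -
  obtain M where "\<forall>i. - int (M * CARD('s)) \<le> a i" using lower_bound_multiple by blast
  with assms show ?thesis using abacus_balanced_iff balanced_is_beta_set by metis
qed

lemma beta_abacus_sum:
  fixes a :: "'s::nontriv mod_ring \<Rightarrow> int"
  assumes a: "transversal a" and lam: "is_partition lam" "beta_set lam = abacus a"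
  shows "(\<Sum>i\<in>UNIV. a i) = int (CARD('s) choose 2)"
proof -
  obtain M0 where M0: "\<And>M i. M0 \<le> M \<Longrightarrow> - int (M * CARD('s)) \<le> a i"
    using lower_bound_multiple[of a] by blast
  obtain N0 where N0: "\<And>N. N0 \<le> N \<Longrightarrow> balanced_above (beta_set lam) N" using beta_set_balanced[OF lam(1)] by blast
  let ?M = "max M0 N0"
  have "N0 * 1 \<le> ?M * CARD('s)" by (intro mult_le_mono) (simp_all add: Suc_leI)
  then have "balanced_above (abacus a) (?M * CARD('s))" using N0 lam(2) by simp
  then show ?thesis using abacus_balanced_iff[OF a, of ?M] M0[OF max.cobounded1] by blast
qed

definition core_height :: "(nat \<Rightarrow> nat) \<Rightarrow> 's::nontriv mod_ring \<Rightarrow> int" where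
  "core_height lam i = (LEAST a. a \<in> residue_class i \<and> a \<notin> beta_set lam)"

text \<open>
  On the integers \<open>LEAST\<close> is meaningful only if a minimum exists. The candidates are bounded below
  because all sufficiently small integers are beta-numbers, and there is one because no beta-number
  reaches the first part of the partition.
\<close>

lemma core_height_least:
  assumes lam: "is_partition lam"
  shows "core_height lam i \<in> residue_class (i :: 's::nontriv mod_ring)" "core_height lam i \<notin> beta_set lam"
    and "\<And>b. b \<in> residue_class i \<Longrightarrow> b \<notin> beta_set lam \<Longrightarrow> core_height lam i \<le> b"
proof -
  let ?P = "\<lambda>b. b \<in> residue_class i \<and> b \<notin> beta_set lam"
  obtain N where N: "balanced_above (beta_set lam) N" using beta_set_balanced[OF lam] by blast
  then have low: "- int N \<le> b" if "?P b" for b using that by (force simp: balanced_above_def)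
  obtain r where r: "(of_int r :: 's mod_ring) = i" using surj_of_int_mod_ring by blast
  \<comment> \<open>A member of the class of \<open>i\<close> that is at least \<open>lam 1\<close>.\<close>
  define b0 where "b0 = r + (\<bar>r\<bar> + int (lam 1)) * int CARD('s)"
  have "(of_int b0 :: 's mod_ring) = of_int r" unfolding of_int_mod_ring_eq_iff by (simp add: b0_def)
  moreover have "b0 \<notin> beta_set lam"
  proof
    assume "b0 \<in> beta_set lam"
    then obtain j where j: "1 \<le> j" "b0 = int (lam j) - int j" by (auto simp: beta_set_def)
    have "(\<bar>r\<bar> + int (lam 1)) * 1 \<le> (\<bar>r\<bar> + int (lam 1)) * int CARD('s)"
      using card_nontriv[where 's='s] by (intro mult_left_mono) auto
    then have "int (lam 1) \<le> b0" by (simp add: b0_def)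
    with j partition_antimono[OF lam, of 1 j] show False by simp
  qed
  ultimately have "?P b0" by (simp add: residue_class_def r)
  then obtain b where b: "?P b" "\<And>c. ?P c \<Longrightarrow> nat (b + int N) \<le> nat (c + int N)"
    using ex_has_least_nat[of ?P b0 "\<lambda>c. nat (c + int N)"] by blast
  have le: "b \<le> c" if "?P c" for c using b(2)[OF that] low[OF b(1)] low[OF that] by linarith
  have "core_height lam i = b" unfolding core_height_def by (rule Least_equality) (use b(1) le in auto)
  with b(1) le show "core_height lam i \<in> residue_class i" "core_height lam i \<notin> beta_set lam"
    "\<And>b. b \<in> residue_class i \<Longrightarrow> b \<notin> beta_set lam \<Longrightarrow> core_height lam i \<le> b" by auto
qed

lemma core_height_transversal:
  assumes "is_partition lam"
  shows "transversal (core_height lam :: 's::nontriv mod_ring \<Rightarrow> int)"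
  unfolding transversal_def
proof
  fix i :: "'s mod_ring"
  show "of_int (core_height lam i) = i"
    using core_height_least(1)[OF assms, of i] by (simp add: residue_class_def)
qed

lemma core_abacus:
  assumes core: "lam \<in> cores CARD('s::nontriv)"
  shows "beta_set lam = abacus (core_height lam :: 's mod_ring \<Rightarrow> int)"
proof -
  have lam: "is_partition lam" using core by (simp add: cores_def)
  have down: "m - int n * int CARD('s) \<in> beta_set lam" if "m \<in> beta_set lam" for m n
  proof (induction n)
    case (Suc n)
    from core_beta_shift[OF core _ Suc.IH] show ?case by (simp add: algebra_simps)
  qed (use that in simp)
  have "m \<in> beta_set lam \<longleftrightarrow> m < core_height lam (of_int m :: 's mod_ring)" for m
  proof
    let ?h = "core_height lam (of_int m :: 's mod_ring)"
    assume m: "m \<in> beta_set lam"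
    show "m < ?h"
    proof (rule ccontr)
      assume "\<not> m < ?h"
      then have "?h \<le> m" by simp
      have "(of_int m :: 's mod_ring) = of_int ?h"
        using core_height_least(1)[OF lam, of "of_int m :: 's mod_ring"] by (simp add: residue_class_def)
      then have "int CARD('s) dvd m - ?h" by (simp add: of_int_mod_ring_eq_iff mod_eq_dvd_iff)
      then obtain q where q: "m - ?h = int CARD('s) * q" by blast
      have "0 \<le> q" using \<open>?h \<le> m\<close> q by (metis diff_ge_0_iff_ge of_nat_0_less_iff zero_less_card_finite zero_le_mult_iff not_le)
      then have "m - int (nat q) * int CARD('s) = ?h" using q by (simp add: algebra_simps)
      with down[OF m, of "nat q"] core_height_least(2)[OF lam] show False by metis
    qed
  next
    assume "m < core_height lam (of_int m :: 's mod_ring)"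
    then show "m \<in> beta_set lam"
      using core_height_least(3)[OF lam, of m "of_int m :: 's mod_ring"] by (auto simp: residue_class_def)
  qed
  then show ?thesis by (auto simp: abacus_def)
qed

lemma core_point_height:
  assumes "is_partition lam"
  shows "core_point lam $ (i :: 's::nontriv mod_ring) = of_int (core_height lam i)"
proof -
  have range: "s_set TYPE('s) lam = range (core_height lam :: 's mod_ring \<Rightarrow> int)"
    by (simp add: s_set_def core_height_def)
  have "(THE b. b \<in> s_set TYPE('s) lam \<inter> residue_class i) = core_height lam i"
  proof (rule the_equality)
    show "core_height lam i \<in> s_set TYPE('s) lam \<inter> residue_class i"
      using core_height_least(1)[OF assms] by (simp add: range)
    fix b assume "b \<in> s_set TYPE('s) lam \<inter> residue_class i"
    then obtain j :: "'s mod_ring" where j: "b = core_height lam j" "of_int b = i"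
      by (auto simp: range residue_class_def)
    then have "j = i" using core_height_transversal[OF assms, where 's='s] by (simp add: transversal_def)
    with j show "b = core_height lam i" by simp
  qed
  then show ?thesis by (simp add: core_point_def)
qed

section \<open>The stabiliser of a core\<close>

text \<open>
  The first gaps of the image of an abacus under the level \<open>t\<close> action: level permutations commute with
  the shift by \<open>s\<close>, so they map runners to runners and first gaps to first gaps.
\<close>

definition moved_heights ::
    "nat \<Rightarrow> (int \<Rightarrow> int) \<Rightarrow> ('s::nontriv mod_ring \<Rightarrow> int) \<Rightarrow> 's mod_ring \<Rightarrow> int" where
  "moved_heights t w a j =
     level_perm TYPE('s) t w (a (level_class t (inv_into UNIV w (level_index t j))))"

lemma moved_heights_class:
  assumes cop: "coprime CARD('s::nontriv) t" and w: "w \<in> carrier (affine_sym CARD('s))"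
    and a: "transversal (a :: 's mod_ring \<Rightarrow> int)"
  shows "moved_heights t w a (level_class t (w k)) = a (level_class t k) + int t * (w k - k)"
proof -
  let ?v = "inv_into UNIV w"
  let ?i = "level_index t (level_class t (w k) :: 's mod_ring)"
  have v: "?v \<in> carrier (affine_sym CARD('s))" by (rule affine_sym_inv[OF _ w]) simp
  have vw: "?v (w k) = k" using w by (simp add: affine_sym_iff bij_def)
  have i: "?i mod int CARD('s) = w k mod int CARD('s)"
    using level_class_index[OF cop, of "level_class t (w k)"] by (simp only: level_class_eq_iff[OF cop])
  then have "?v ?i - ?i = k - w k"
    using shift_cong[of ?v "CARD('s)" 1 ?i "w k"] v by (simp add: affine_sym_iff vw)
  then have "?v ?i = k + (?i - w k)" by simp
  moreover obtain q where "?i - w k = int CARD('s) * q" using i by (metis mod_eq_dvd_iff dvdE)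
  ultimately have "?v ?i mod int CARD('s) = k mod int CARD('s)" by simp
  then have "(level_class t (?v ?i) :: 's mod_ring) = level_class t k" by (simp only: level_class_eq_iff[OF cop])
  then show ?thesis
    using a by (simp add: moved_heights_def transversal_def level_perm_apply[OF cop w])
qed

lemma level_class_cover:
  assumes "coprime CARD('s::nontriv) t" "w \<in> carrier (affine_sym CARD('s))"
  obtains k where "(j :: 's mod_ring) = level_class t (w k)"
proof -
  obtain l where "level_class t l = j" using surj_level_class[OF assms(1)] by blast
  moreover have "w (inv_into UNIV w l) = l" using assms(2) by (simp add: affine_sym_iff bij_def surj_f_inv_f)
  ultimately show thesis using that[of "inv_into UNIV w l"] by simp
qed

lemma transversal_moved_heights:
  assumes cop: "coprime CARD('s::nontriv) t" and w: "w \<in> carrier (affine_sym CARD('s))"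
    and a: "transversal (a :: 's mod_ring \<Rightarrow> int)"
  shows "transversal (moved_heights t w a)"
  unfolding transversal_def
proof
  fix j :: "'s mod_ring"
  obtain k where j: "j = level_class t (w k)" using level_class_cover[OF cop w] .
  have "of_int (a (level_class t k)) = (level_class t k :: 's mod_ring)" using a by (simp add: transversal_def)
  then show "of_int (moved_heights t w a j) = j"
    unfolding j moved_heights_class[OF cop w a] by (simp add: level_class_def algebra_simps)
qed

lemma level_perm_abacus:
  assumes cop: "coprime CARD('s::nontriv) t" and w: "w \<in> carrier (affine_sym CARD('s))"
    and a: "transversal (a :: 's mod_ring \<Rightarrow> int)"
  shows "level_perm TYPE('s) t w ` abacus a = abacus (moved_heights t w a)"
proof -
  let ?p = "level_perm TYPE('s) t w"
  have iff: "?p m \<in> abacus (moved_heights t w a) \<longleftrightarrow> m \<in> abacus a" for m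
  proof -
    obtain k where k: "(of_int m :: 's mod_ring) = level_class t k" using surj_level_class[OF cop] by metis
    show ?thesis
      unfolding abacus_def mem_Collect_eq level_perm_class[OF cop w k] moved_heights_class[OF cop w a]
      by (simp add: level_perm_apply[OF cop w k] k)
  qed
  show ?thesis
  proof (intro equalityI subsetI)
    fix m assume m: "m \<in> abacus (moved_heights t w a)"
    obtain m' where "m = ?p m'" using bij_level_perm[OF cop w] by (metis bij_pointE)
    with m iff show "m \<in> ?p ` abacus a" by blast
  qed (use iff in blast)
qed

lemma sum_moved_heights:
  assumes cop: "coprime CARD('s::nontriv) t" and w: "w \<in> carrier (affine_sym CARD('s))"
    and a: "transversal (a :: 's mod_ring \<Rightarrow> int)"
  shows "(\<Sum>j\<in>UNIV. moved_heights t w a j) = (\<Sum>j\<in>UNIV. a j)"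
proof -
  let ?I = "{0..<int CARD('s)}"
  have "(\<Sum>j\<in>UNIV. moved_heights t w a j) = (\<Sum>k\<in>?I. moved_heights t w a (level_class t k))"
    by (rule sum_level_class[OF cop, symmetric])
  also have "\<dots> = (\<Sum>k\<in>?I. moved_heights t w a (level_class t (w k)))"
  proof (rule sum_period_reindex[symmetric])
    show "moved_heights t w a (level_class t (m + int CARD('s))) = moved_heights t w a (level_class t m)" for m
      using level_class_eq_iff[OF cop, of "m + int CARD('s)" m] by simp
  qed (use w in \<open>auto simp: affine_sym_iff\<close>)
  also have "\<dots> = (\<Sum>k\<in>?I. a (level_class t k)) + int t * (\<Sum>k\<in>?I. w k - k)"
    by (simp only: moved_heights_class[OF cop w a] sum.distrib sum_distrib_left)
  also have "(\<Sum>k\<in>?I. w k - k) = 0" using w by (simp add: affine_sym_iff)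
  finally show ?thesis by (simp add: sum_level_class[OF cop])
qed

text \<open>
  The level action preserves the sum of the first gaps, hence charge zero. So the image of the
  beta-set is a beta-set, and comparing partitions amounts to comparing first gaps.
\<close>

lemma core_action_fixes_iff:
  assumes cop: "coprime CARD('s::nontriv) t" and w: "w \<in> carrier (affine_sym CARD('s))"
    and core: "lam \<in> cores CARD('s)"
  shows "core_action TYPE('s) t w lam = lam \<longleftrightarrow>
    moved_heights t w (core_height lam) = (core_height lam :: 's mod_ring \<Rightarrow> int)"
proof -
  let ?a = "core_height lam :: 's mod_ring \<Rightarrow> int"
  let ?b = "moved_heights t w ?a"
  have lam: "is_partition lam" using core by (simp add: cores_def)
  have B: "beta_set lam = abacus ?a" by (rule core_abacus[OF core])
  have a: "transversal ?a" by (rule core_height_transversal[OF lam])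
  have b: "transversal ?b" by (rule transversal_moved_heights[OF cop w a])
  have "(\<Sum>j\<in>UNIV. ?b j) = int (CARD('s) choose 2)"
    using beta_abacus_sum[OF a lam B] by (simp add: sum_moved_heights[OF cop w a])
  then obtain mu where mu: "is_partition mu" "beta_set mu = abacus ?b"
    using abacus_is_beta_set[OF b] by blast
  have "core_action TYPE('s) t w lam = (THE mu. is_partition mu \<and> beta_set mu = abacus ?b)"
    using core by (simp add: core_action_def level_action_eq[OF cop w] B level_perm_abacus[OF cop w a])
  also have "\<dots> = mu"
    by (rule the_equality) (use mu beta_set_injective in auto)
  finally have "core_action TYPE('s) t w lam = mu" .
  moreover have "mu = lam \<longleftrightarrow> abacus ?b = abacus ?a"
    using beta_set_injective[OF mu(1) lam] mu(2) B by auto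
  moreover have "abacus ?b = abacus ?a \<longleftrightarrow> ?b = ?a" using abacus_injective[OF b a] by auto
  ultimately show ?thesis by simp
qed

text \<open>
  The gap on runner \<open>k\<close> moves to runner \<open>w k\<close> with a displacement of \<open>t (w k - k)\<close>, which is exactly
  the linear term in the unrolled sequence.
\<close>

lemma stabilizer_unrolled:
  assumes cop: "coprime CARD('s::nontriv) t" and core: "lam \<in> cores CARD('s)"
  shows "stabilizer (affine_sym CARD('s)) (core_action TYPE('s) t) lam =
    {w \<in> carrier (affine_sym CARD('s)).
       unrolled t (core_point lam :: real ^ 's mod_ring) \<circ> w = unrolled t (core_point lam :: real ^ 's mod_ring)}"
proof -
  let ?a = "core_height lam :: 's mod_ring \<Rightarrow> int"
  let ?X = "unrolled t (core_point lam :: real ^ 's mod_ring)"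
  have lam: "is_partition lam" using core by (simp add: cores_def)
  have a: "transversal ?a" by (rule core_height_transversal[OF lam])
  have "core_action TYPE('s) t w lam = lam \<longleftrightarrow> ?X \<circ> w = ?X" if w: "w \<in> carrier (affine_sym CARD('s))" for w
  proof -
    have "moved_heights t w ?a = ?a \<longleftrightarrow> (\<forall>k. moved_heights t w ?a (level_class t (w k)) = ?a (level_class t (w k)))"
      using level_class_cover[OF cop w] by (metis ext)
    also have "\<dots> \<longleftrightarrow> (\<forall>k. ?X (w k) = ?X k)"
    proof (intro all_cong1)
      fix k
      have "?X (w k) = ?X k \<longleftrightarrow>
          real_of_int (?a (level_class t k) + int t * (w k - k)) = real_of_int (?a (level_class t (w k)))"
        by (auto simp: unrolled_def core_point_height[OF lam] algebra_simps)
      then show "moved_heights t w ?a (level_class t (w k)) = ?a (level_class t (w k)) \<longleftrightarrow> ?X (w k) = ?X k"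
        unfolding moved_heights_class[OF cop w a] of_int_eq_iff by blast
    qed
    finally show ?thesis unfolding core_action_fixes_iff[OF cop w core] by (simp add: fun_eq_iff)
  qed
  then show ?thesis by (auto simp: stabilizer_def)
qed

text \<open>
  This is where the second core condition enters. If the first gap on the runner of \<open>k + 1\<close> were larger
  than \<open>m + t\<close>, with \<open>m\<close> the first gap on the runner of \<open>k\<close>, then \<open>m + t\<close> would be a beta-number,
  and subtracting \<open>t\<close> would make \<open>m\<close> one. Geometrically, the point of an \<open>(s, t)\<close>-core lies in the closed
  alcove bounded by the walls.
\<close>

lemma core_point_antimono:
  assumes s_core: "lam \<in> cores CARD('s::nontriv)" and t_core: "lam \<in> cores t" and "0 < t"
  shows "unrolled t (core_point lam :: real ^ 's mod_ring) (k + 1) \<le> unrolled t (core_point lam :: real ^ 's mod_ring) k"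
proof -
  let ?a = "core_height lam :: 's mod_ring \<Rightarrow> int"
  let ?m = "?a (level_class t k)"
  have lam: "is_partition lam" using s_core by (simp add: cores_def)
  have a: "transversal ?a" by (rule core_height_transversal[OF lam])
  have cls: "(of_int (?m + int t) :: 's mod_ring) = level_class t (k + 1)"
    using a by (simp add: transversal_def level_class_shift)
  have "?a (level_class t (k + 1)) \<le> ?m + int t"
  proof (rule ccontr)
    assume "\<not> ?a (level_class t (k + 1)) \<le> ?m + int t"
    then have "?m + int t \<in> beta_set lam"
      unfolding core_abacus[OF s_core] abacus_def mem_Collect_eq cls by simp
    from core_beta_shift[OF t_core \<open>0 < t\<close> this] show False
      using core_height_least(2)[OF lam, of "level_class t k :: 's mod_ring"] by simp
  qed
  then have "real_of_int (?a (level_class t (k + 1))) \<le> real_of_int ?m + real t"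
    by (metis of_int_add of_int_le_iff of_int_of_nat_eq)
  then show ?thesis by (simp add: unrolled_def core_point_height[OF lam] algebra_simps)
qed

lemma core_point_in_sum_space:
  assumes "lam \<in> cores CARD('s::nontriv)"
  shows "core_point lam \<in> (sum_space :: (real ^ 's mod_ring) set)"
proof -
  have lam: "is_partition lam" using assms by (simp add: cores_def)
  have "(\<Sum>j\<in>UNIV. core_height lam (j :: 's mod_ring)) = int (CARD('s) choose 2)"
    by (rule beta_abacus_sum[OF core_height_transversal[OF lam] lam core_abacus[OF assms]])
  then have "real_of_int (\<Sum>j\<in>UNIV. core_height lam (j :: 's mod_ring)) = real (CARD('s) choose 2)"
    by simp
  then show ?thesis by (simp add: sum_space_def core_point_height[OF lam])
qed

text \<open>
  A generator preserves the unrolled sequence iff its reflection fixes the point, that is, iff the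
  point lies on the corresponding wall.
\<close>

lemma generators_to_reflections:
  assumes cop: "coprime CARD('s::nontriv) t" and x: "x \<in> (sum_space :: (real ^ 's mod_ring) set)"
  shows "geometric_action t ` {affine_gen i | i :: 's mod_ring. unrolled t x \<circ> affine_gen i = unrolled t x} =
    {wall_reflection t j | j. x \<in> wall t j}"
proof -
  let ?X = "unrolled t x"
  have fix_iff: "?X \<circ> affine_gen (of_int (k + 1) :: 's mod_ring) = ?X \<longleftrightarrow> x \<in> wall t (level_class t (k + 1))" for k
  proof -
    let ?g = "affine_gen (of_int (k + 1) :: 's mod_ring)"
    have ginv: "inv_into UNIV ?g = ?g" by (rule inv_unique_comp) (auto simp: affine_gen_involution)
    show ?thesis
    proof
      assume "?X \<circ> ?g = ?X"
      then have "?X (?g k) = ?X k" by (metis comp_apply)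
      moreover have "?g k = k + 1" by (simp add: affine_gen_apply)
      ultimately show "x \<in> wall t (level_class t (k + 1))" using x by (simp only: wall_unrolled)
    next
      assume "x \<in> wall t (level_class t (k + 1))"
      then have "closest_point (wall t (level_class t (k + 1))) x = x" by (rule closest_point_self)
      then have "wall_reflection t (level_class t (k + 1)) x = x"
        using x by (simp add: wall_reflection_def scaleR_2)
      then have "geometric_action t ?g x = x" unfolding geometric_action_gen[OF cop] .
      then show "?X \<circ> ?g = ?X"
        using unrolled_geometric_action[OF cop affine_gen_in_affine_sym x] by (metis ginv)
    qed
  qed
  show ?thesis
  proof (intro equalityI subsetI)
    fix f :: "real ^ 's mod_ring \<Rightarrow> real ^ 's mod_ring"
    assume "f \<in> geometric_action t ` {affine_gen i | i :: 's mod_ring. ?X \<circ> affine_gen i = ?X}"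
    then obtain i :: "'s mod_ring" where i: "?X \<circ> affine_gen i = ?X" "f = geometric_action t (affine_gen i)" by blast
    obtain m where "of_int m = i" using surj_of_int_mod_ring by blast
    then have m: "i = of_int ((m - 1) + 1)" by simp
    show "f \<in> {wall_reflection t j | j. x \<in> wall t j}"
      using i fix_iff[of "m - 1"] geometric_action_gen[OF cop, of "m - 1"] unfolding m by blast
  next
    fix f :: "real ^ 's mod_ring \<Rightarrow> real ^ 's mod_ring"
    assume "f \<in> {wall_reflection t j | j. x \<in> wall t j}"
    then obtain j where j: "x \<in> wall t j" "f = wall_reflection t j" by blast
    obtain m where "level_class t m = j" using surj_level_class[OF cop] by blast
    then have m: "j = level_class t ((m - 1) + 1)" by simp
    show "f \<in> geometric_action t ` {affine_gen i | i :: 's mod_ring. ?X \<circ> affine_gen i = ?X}"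
    proof (rule image_eqI)
      show "f = geometric_action t (affine_gen (of_int ((m - 1) + 1) :: 's mod_ring))"
        unfolding j(2) m by (rule geometric_action_gen[OF cop, symmetric])
      have "?X \<circ> affine_gen (of_int ((m - 1) + 1) :: 's mod_ring) = ?X"
        using j(1) unfolding m fix_iff .
      then show "affine_gen (of_int ((m - 1) + 1) :: 's mod_ring) \<in> {affine_gen i | i :: 's mod_ring. ?X \<circ> affine_gen i = ?X}"
        by blast
    qed
  qed
qed

theorem corollary3p11:
  fixes s t :: nat and lam :: "nat \<Rightarrow> nat"
  assumes "CARD('s::nontriv) = s"
    and "2 \<le> s" and "1 \<le> t" and "coprime s t"
    and "lam \<in> cores s \<inter> cores t"
  shows "core_stabilizer TYPE('s) t lam \<cong> reflection_group TYPE('s) t lam"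
proof -
  let ?G = "affine_sym CARD('s)"
  let ?H = "BijGroup (sum_space :: (real ^ 's mod_ring) set)"
  let ?x = "core_point lam :: real ^ 's mod_ring"
  let ?X = "unrolled t ?x"
  let ?K = "{affine_gen i | i :: 's mod_ring. ?X \<circ> affine_gen i = ?X}"
  let ?R = "{wall_reflection t j | j. ?x \<in> wall t j}"
  let ?h = "geometric_action t :: _ \<Rightarrow> real ^ 's mod_ring \<Rightarrow> _"
  have cop: "coprime CARD('s) t" and t: "0 < t"
    and s_core: "lam \<in> cores CARD('s)" and t_core: "lam \<in> cores t"
    using assms by auto
  interpret group_hom ?G ?H ?h by (rule geometric_action_hom[OF cop])
  have K: "?K \<subseteq> carrier ?G" using affine_gen_in_affine_sym by auto
  have "stabilizer ?G (core_action TYPE('s) t) lam = {w \<in> carrier ?G. ?X \<circ> w = ?X}"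
    by (rule stabilizer_unrolled[OF cop s_core])
  also have "\<dots> = generate ?G ?K"
    by (rule antimono_stabilizer_generated[OF core_point_antimono[OF s_core t_core t] unrolled_shift[OF cop]])
  finally have stab: "core_stabilizer TYPE('s) t lam = ?G\<lparr>carrier := generate ?G ?K\<rparr>"
    by (simp add: core_stabilizer_def)
  have img: "?h ` ?K = ?R"
    by (rule generators_to_reflections[OF cop core_point_in_sum_space[OF s_core]])
  have "?h ` ?K \<subseteq> carrier ?H"
    by (rule image_subsetI, rule hom_closed, erule subsetD[OF K])
  then have "?R \<subseteq> carrier ?H" by (simp only: img)
  then have refl: "reflection_group TYPE('s) t lam = ?H\<lparr>carrier := ?h ` generate ?G ?K\<rparr>"
    using generate_img[OF K] by (simp add: reflection_group_def subgroup_generated_def Int_absorb1 img)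
  have sub: "generate ?G ?K \<subseteq> carrier ?G" by (rule G.generate_incl[OF K])
  have "?h \<in> iso (?G\<lparr>carrier := generate ?G ?K\<rparr>) (?H\<lparr>carrier := ?h ` generate ?G ?K\<rparr>)"
  proof (rule isoI)
    show "?h \<in> hom (?G\<lparr>carrier := generate ?G ?K\<rparr>) (?H\<lparr>carrier := ?h ` generate ?G ?K\<rparr>)"
      using sub by (intro homI) (auto simp: subset_iff)
    show "bij_betw ?h (carrier (?G\<lparr>carrier := generate ?G ?K\<rparr>)) (carrier (?H\<lparr>carrier := ?h ` generate ?G ?K\<rparr>))"
      using inj_on_subset[OF geometric_action_inj[OF cop t] sub] by (simp add: bij_betw_def)
  qed
  then show ?thesis unfolding stab refl by (rule is_isoI)
qed

end
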